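(* Let $I$ be a two-sided ideal of $\mathrm{U}(W_+)$ that contains a nonzero element $f$ of order $o(f)\leq 2$. Then $\operatorname{GKdim}\mathrm{U}(W_+)/I<\infty$.
   Context: $\Bbbk$ is a field of characteristic zero. The positive Witt algebra $W_+$ is the Lie algebra over $\Bbbk$ with basis $\{e_n : n\in\mathbb{Z}_{\geq 1}\}$ and bracket $[e_i,e_j]=(j-i)e_{i+j}$; $\mathrm{U}(W_+)$ is its universal enveloping algebra. The order $o(f)$ of a nonzero $f\in\mathrm{U}(W_+)$ is its degree in the standard filtration of the enveloping algebra, in which each $e_i$ has order $1$: it is the least $m$ such that $f$ is a linear combination of products of at most $m$ of the $e_i$. The Gelfand-Kirillov dimension of a $\Bbbk$-algebra $R$ is $\operatorname{GKdim}R=\sup_V\limsup_{n\to\infty}\log_n\dim_\Bbbk\left(\sum_{k=0}^nV^k\right)$, the supremum over finite-dimensional subspaces $V\subseteq R$ (for the zero algebra this is $-\infty$, which counts as $<\infty$). *)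

theory Defs
  imports
    "HOL-Library.Poly_Mapping"
    "HOL-Library.Extended_Real"
    "HOL-Library.Liminf_Limsup"
    "HOL-Algebra.QuotRing"
    "Jordan_Normal_Form.VS_Connect"
begin

text \<open>An algebra over a field, not necessarily commutative, is represented by a \<^typ>\<open>('k, 'a) module\<close>
  record; the scalars are a type of class \<^class>\<open>field\<close>, seen as the record \<^term>\<open>class_ring\<close>.\<close>

abbreviation lin_span :: "('k::field, 'a, 'm) module_scheme \<Rightarrow> 'a set \<Rightarrow> 'a set" where
  "lin_span A \<equiv> LinearCombinations.module.span class_ring A"

text \<open>The ring part is the library's factor ring; scalars act by \<open>c (I + x) = I + c x\<close>.\<close>

definition quot_algebra :: "('k, 'a, 'm) module_scheme \<Rightarrow> 'a set \<Rightarrow> ('k, 'a set) module" where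
  "quot_algebra A I = ring.extend (A Quot I)
     (module.fields (\<lambda>c X. \<Union>x\<in>X. I +>\<^bsub>A\<^esub> (c \<odot>\<^bsub>A\<^esub> x)))"


section \<open>Gelfand-Kirillov dimension\<close>

definition prod_space :: "('k::field, 'a, 'm) module_scheme \<Rightarrow> 'a set \<Rightarrow> 'a set \<Rightarrow> 'a set" where
  "prod_space A V W = lin_span A {v \<otimes>\<^bsub>A\<^esub> w | v w. v \<in> V \<and> w \<in> W}"

fun pow_space :: "('k::field, 'a, 'm) module_scheme \<Rightarrow> 'a set \<Rightarrow> nat \<Rightarrow> 'a set" where
  "pow_space A V 0 = lin_span A {\<one>\<^bsub>A\<^esub>}"
| "pow_space A V (Suc k) = prod_space A (pow_space A V k) V"

definition sum_pow_space :: "('k::field, 'a, 'm) module_scheme \<Rightarrow> 'a set \<Rightarrow> nat \<Rightarrow> 'a set" where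
  "sum_pow_space A V n = lin_span A (\<Union>k\<le>n. pow_space A V k)"

abbreviation space_dim :: "('k::field, 'a, 'm) module_scheme \<Rightarrow> 'a set \<Rightarrow> nat" where
  "space_dim A V \<equiv> vectorspace.dim class_ring (A\<lparr>carrier := V\<rparr>)"

text \<open>The convention \<open>log\<^sub>n 0 = -\<infinity>\<close> gives the zero algebra the dimension \<open>-\<infinity>\<close>. The values at
  \<open>n = 0, 1\<close> are irrelevant to the limit superior.\<close>

definition log_dim :: "nat \<Rightarrow> nat \<Rightarrow> ereal" where
  "log_dim n d = (if d = 0 then -\<infinity> else ereal (log (real n) (real d)))"

definition GKdim :: "('k::field, 'a, 'm) module_scheme \<Rightarrow> ereal" where
  "GKdim A = (SUP V \<in> {V. subspace class_ring V A \<and>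
                           vectorspace.fin_dim class_ring (A\<lparr>carrier := V\<rparr>)}.
                limsup (\<lambda>n. log_dim n (space_dim A (sum_pow_space A V n))))"


section \<open>Universal enveloping algebras\<close>

datatype 'i monomial = Monomial (letters: "'i list")

instantiation monomial :: (type) monoid_add
begin

definition zero_monomial :: "'a monomial" where
  "0 = Monomial []"

definition plus_monomial :: "'a monomial \<Rightarrow> 'a monomial \<Rightarrow> 'a monomial" where
  "u + v = Monomial (letters u @ letters v)"

instance
  by standard (simp_all add: zero_monomial_def plus_monomial_def)

end

text \<open>The space with basis \<open>S\<close> consists of the finitely supported functions on \<open>S\<close>. Its tensor
  algebra is the free associative algebra on \<open>S\<close>: the span of the monomials, the multiplication
  of \<^typ>\<open>'i monomial \<Rightarrow>\<^sub>0 'k\<close> being the linear extension of concatenation.\<close>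

definition space_on :: "'i set \<Rightarrow> ('i \<Rightarrow>\<^sub>0 'k::zero) set" where
  "space_on S = {x. Poly_Mapping.keys x \<subseteq> S}"

definition tensor_algebra :: "'i set \<Rightarrow> ('k::field, 'i monomial \<Rightarrow>\<^sub>0 'k) module" where
  "tensor_algebra S =
     \<lparr>carrier = {p. \<forall>w\<in>Poly_Mapping.keys p. set (letters w) \<subseteq> S}, mult = (*), one = 1,
      zero = 0, add = (+), smult = (\<lambda>c. Poly_Mapping.map ((*) c))\<rparr>"

definition tensor_incl :: "('i \<Rightarrow>\<^sub>0 'k::field) \<Rightarrow> ('i monomial \<Rightarrow>\<^sub>0 'k)" where
  "tensor_incl x = (\<Sum>i\<in>Poly_Mapping.keys x. Poly_Mapping.single (Monomial [i]) (Poly_Mapping.lookup x i))"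

text \<open>\<open>env_ideal S br\<close> is the ideal generated by the elements
  \<open>x \<otimes> y - y \<otimes> x - [x,y]\<close>, for the Lie algebra with basis \<open>S\<close> and bracket \<open>br\<close>.\<close>

definition env_ideal ::
  "'i set \<Rightarrow> (('i \<Rightarrow>\<^sub>0 'k) \<Rightarrow> ('i \<Rightarrow>\<^sub>0 'k) \<Rightarrow> ('i \<Rightarrow>\<^sub>0 'k)) \<Rightarrow> ('i monomial \<Rightarrow>\<^sub>0 'k::field) set" where
  "env_ideal S br = Idl\<^bsub>tensor_algebra S :: ('k, 'i monomial \<Rightarrow>\<^sub>0 'k) module\<^esub>
     {tensor_incl x * tensor_incl y - tensor_incl y * tensor_incl x - tensor_incl (br x y) | x y.
        x \<in> space_on S \<and> y \<in> space_on S}"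

definition univ_env ::
  "'i set \<Rightarrow> (('i \<Rightarrow>\<^sub>0 'k) \<Rightarrow> ('i \<Rightarrow>\<^sub>0 'k) \<Rightarrow> ('i \<Rightarrow>\<^sub>0 'k))
     \<Rightarrow> ('k::field, ('i monomial \<Rightarrow>\<^sub>0 'k) set) module" where
  "univ_env S br = quot_algebra (tensor_algebra S) (env_ideal S br)"

definition univ_env_incl ::
  "'i set \<Rightarrow> (('i \<Rightarrow>\<^sub>0 'k) \<Rightarrow> ('i \<Rightarrow>\<^sub>0 'k) \<Rightarrow> ('i \<Rightarrow>\<^sub>0 'k))
     \<Rightarrow> ('i \<Rightarrow>\<^sub>0 'k::field) \<Rightarrow> ('i monomial \<Rightarrow>\<^sub>0 'k) set" where
  "univ_env_incl S br x =
     env_ideal S br +>\<^bsub>tensor_algebra S :: ('k, 'i monomial \<Rightarrow>\<^sub>0 'k) module\<^esub> tensor_incl x"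


section \<open>The positive Witt algebra\<close>

definition witt_bracket :: "(nat \<Rightarrow>\<^sub>0 'k::field) \<Rightarrow> (nat \<Rightarrow>\<^sub>0 'k) \<Rightarrow> (nat \<Rightarrow>\<^sub>0 'k)" where
  "witt_bracket x y =
     (\<Sum>i\<in>Poly_Mapping.keys x. \<Sum>j\<in>Poly_Mapping.keys y.
        Poly_Mapping.single (i + j) ((of_nat j - of_nat i) * (Poly_Mapping.lookup x i * Poly_Mapping.lookup y j)))"

text \<open>The index \<open>0\<close> does not belong to the basis \<open>{1..}\<close> of \<open>W\<^sub>+\<close>.\<close>

definition UW :: "('k::field, (nat monomial \<Rightarrow>\<^sub>0 'k) set) module" where
  "UW = univ_env {1..} witt_bracket"

definition UW_gen :: "nat \<Rightarrow> (nat monomial \<Rightarrow>\<^sub>0 'k::field) set" where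
  "UW_gen i = univ_env_incl {1..} witt_bracket (Poly_Mapping.single i 1)"

definition UW_filtration :: "nat \<Rightarrow> (nat monomial \<Rightarrow>\<^sub>0 'k::field) set set" where
  "UW_filtration m = lin_span UW
     {foldr (\<lambda>i u. UW_gen i \<otimes>\<^bsub>UW\<^esub> u) is \<one>\<^bsub>UW\<^esub> | is. length is \<le> m \<and> set is \<subseteq> {1..}}"

definition UW_order :: "(nat monomial \<Rightarrow>\<^sub>0 'k::field) set \<Rightarrow> nat" where
  "UW_order f = (LEAST m. f \<in> UW_filtration m)"

end

theory Submission
  imports Defs
begin

text \<open>
  Multiplying by a power of \<open>e\<^sub>1\<close>, we may assume that
  \<open>f = \<Sum> c\<^sub>i\<^sub>j e\<^sub>i e\<^sub>j\<close> plus terms of order at most 1, where \<open>i \<le> j\<close> and not all \<open>c\<^sub>i\<^sub>j\<close> vanish. Let \<open>(d, q)\<close> be the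
  lexicographically largest pair \<open>(i + j, j)\<close> with \<open>c\<^sub>i\<^sub>j \<noteq> 0\<close> and put \<open>p = d - q\<close>. Modulo linear terms and
  products with a letter at most \<open>d\<close>, the element \<open>[e\<^sub>m, [e\<^sub>n, f]]\<close> of the ideal is the sum of
  \<open>c\<^sub>i\<^sub>j ((j - n) (i - m) e\<^bsub>j+n\<^esub> e\<^bsub>i+m\<^esub> + (i - n) (j - m) e\<^bsub>i+n\<^esub> e\<^bsub>j+m\<^esub>)\<close>. For \<open>n = x - q\<close> and \<open>m = y - p\<close> with
  \<open>x\<close> and \<open>y\<close> large its leading term is \<open>e\<^sub>x e\<^sub>y\<close>, with a nonzero coefficient because the characteristic is
  zero. By induction on \<open>(x + y, x)\<close>, every \<open>e\<^sub>x e\<^sub>y\<close> is congruent to a combination of products \<open>e\<^sub>a e\<^sub>b\<close> with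
  \<open>a \<le> K\<close> and terms of order at most 1. The quotient is therefore spanned by monomials with at most one
  letter above \<open>K\<close>, and the number of these of weight at most \<open>N\<close> is polynomial in \<open>N\<close>. Only the spanning half of
  the Poincare-Birkhoff-Witt theorem is involved.
\<close>

section \<open>The free associative algebra\<close>

text \<open>The scalar multiplication of \<open>tensor_algebra\<close>, named so that spans and
  subspaces in the free algebra are those of the vector space \<open>fa\<close> on the whole
  type.\<close>

definition scl :: "'k::field \<Rightarrow> ('i monomial \<Rightarrow>\<^sub>0 'k) \<Rightarrow> ('i monomial \<Rightarrow>\<^sub>0 'k)" where
  "scl c = Poly_Mapping.map ((*) c)"

lemma scl_conv_mult: "scl c p = Poly_Mapping.single 0 c * p"
  by (simp add: scl_def mult_map_scale_conv_mult)

lemma lookup_scl [simp]: "Poly_Mapping.lookup (scl c p) w = c * Poly_Mapping.lookup p w"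
  by (simp add: scl_def Poly_Mapping.map.rep_eq when_def)

interpretation fa: vector_space "scl :: 'k::field \<Rightarrow> ('i monomial \<Rightarrow>\<^sub>0 'k) \<Rightarrow> _"
  by standard (auto intro!: poly_mapping_eqI simp: lookup_add algebra_simps)

lemma poly_mapping_sum_keys:
  "p = (\<Sum>w\<in>Poly_Mapping.keys p. Poly_Mapping.single w (Poly_Mapping.lookup p w))"
  by (rule poly_mapping_eqI) (auto simp: lookup_sum lookup_single when_def sum.If_cases in_keys_iff
      sum.delta)

lemma single_zero_commute:
  fixes p :: "'i monomial \<Rightarrow>\<^sub>0 'k::field"
  shows "p * Poly_Mapping.single 0 c = Poly_Mapping.single 0 c * p"
proof -
  have "Poly_Mapping.single w a * Poly_Mapping.single 0 c =
      Poly_Mapping.single 0 c * Poly_Mapping.single w a" for w :: "'i monomial" and a :: 'k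
    by (simp add: mult_single mult.commute)
  then show ?thesis
    by (subst (1 2) poly_mapping_sum_keys[of p]) (simp add: sum_distrib_left sum_distrib_right)
qed

lemma scl_mult_left: "scl c p * q = scl c (p * q)"
  by (simp add: scl_conv_mult mult.assoc)

lemma scl_mult_right: "p * scl c q = scl c (p * q)"
  by (metis scl_conv_mult single_zero_commute mult.assoc)

definition word :: "'i list \<Rightarrow> ('i monomial \<Rightarrow>\<^sub>0 'k::field)" where
  "word u = Poly_Mapping.single (Monomial u) 1"

lemma word_append: "word (u @ v) = word u * word v"
  by (simp add: word_def mult_single plus_monomial_def)

lemma word_Nil: "word [] = 1"
  by (metis word_def single_one zero_monomial_def)

lemma scl_word: "scl c (word u) = Poly_Mapping.single (Monomial u) c"
  by (rule poly_mapping_eqI) (simp add: word_def lookup_single when_def)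

lemma sum_words:
  "p = (\<Sum>w\<in>Poly_Mapping.keys p. scl (Poly_Mapping.lookup p w) (word (letters w)))"
  by (simp add: scl_word flip: poly_mapping_sum_keys)

definition free_alg :: "'i set \<Rightarrow> ('i monomial \<Rightarrow>\<^sub>0 'k::field) set" where
  "free_alg S = {p. \<forall>w\<in>Poly_Mapping.keys p. set (letters w) \<subseteq> S}"

lemma subspace_supported:
  "fa.subspace {p :: 'i monomial \<Rightarrow>\<^sub>0 'k::field. \<forall>w\<in>Poly_Mapping.keys p. P w}"
  by (rule fa.subspaceI) (use keys_add in \<open>fastforce simp: in_keys_iff lookup_add\<close>)+

lemma subspace_free_alg: "fa.subspace (free_alg S)"
  unfolding free_alg_def by (rule subspace_supported)

lemma word_in_free_alg [simp]: "word u \<in> free_alg S \<longleftrightarrow> set u \<subseteq> S"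
  by (simp add: free_alg_def word_def)

lemma mult_in_free_alg:
  assumes "p \<in> free_alg S" "q \<in> free_alg S"
  shows "p * q \<in> free_alg S"
  unfolding free_alg_def
proof (intro CollectI ballI)
  fix w assume "w \<in> Poly_Mapping.keys (p * q)"
  then obtain u v where "w = u + v" "u \<in> Poly_Mapping.keys p" "v \<in> Poly_Mapping.keys q"
    using keys_mult[of p q] by blast
  then show "set (letters w) \<subseteq> S"
    using assms by (auto simp: free_alg_def plus_monomial_def)
qed

section \<open>Words\<close>

text \<open>Additive under concatenation. Replacing two letters by their sum lowers it by
  \<open>C\<close>, so commutator corrections respect any bound on the weight.\<close>

definition weight :: "nat \<Rightarrow> nat list \<Rightarrow> nat" where
  "weight C u = sum_list u + C * length u"

lemma weight_simps [simp]:
  "weight C [] = 0" "weight C (x # u) = x + C + weight C u" "weight C (u @ v) = weight C u + weight C v"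
  by (simp_all add: weight_def algebra_simps)

lemma weight_mset: "mset u = mset v \<Longrightarrow> weight C u = weight C v"
  by (metis mset_eq_length sum_mset_sum_list weight_def)

text \<open>Collects the correction terms left by reordering a word of length at most
  \<open>n\<close>.\<close>

definition shorter :: "nat \<Rightarrow> nat \<Rightarrow> nat \<Rightarrow> nat list set" where
  "shorter C n N = {u. set u \<subseteq> {1..} \<and> length u < n \<and> weight C u \<le> N}"

text \<open>The relation derived from a quadratic element rewrites \<open>e\<^sub>x e\<^sub>y\<close> with \<open>x + y = D\<close>. The slack \<open>C\<close> in the
  degree of the linear terms is paid for by the summand \<open>C * length u\<close> of the weight.\<close>

definition quadratic_nf :: "nat \<Rightarrow> nat \<Rightarrow> nat \<Rightarrow> nat list set" where
  "quadratic_nf K C D = {[a, b] | a b. 1 \<le> a \<and> a \<le> K \<and> 1 \<le> b \<and> a + b \<le> D} \<union>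
     {u. set u \<subseteq> {1..} \<and> length u \<le> 1 \<and> sum_list u \<le> D + C}"

definition small_part :: "nat \<Rightarrow> (nat \<Rightarrow> nat) \<Rightarrow> nat list" where
  "small_part K c = concat (map (\<lambda>i. replicate (c i) i) [1..<Suc K])"

text \<open>The value \<open>b = 0\<close> encodes the absence of a letter above \<open>K\<close>.\<close>

definition nf :: "nat \<Rightarrow> nat \<Rightarrow> nat list set" where
  "nf K N = (\<lambda>(c, b). small_part K c @ (if b = 0 then [] else [b])) ` (({1..K} \<rightarrow>\<^sub>E {..N}) \<times> {..N})"

text \<open>Each of the \<open>K\<close> multiplicities and the one further letter has
  \<open>N + 1\<close> possible values.\<close>

lemma card_nf: "finite (nf K N)" "card (nf K N) \<le> (N + 1) ^ (K + 1)"
proof -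
  have fin: "finite (({1..K} \<rightarrow>\<^sub>E {..N}) \<times> {..N})"
    by (intro finite_cartesian_product finite_PiE) auto
  then show "finite (nf K N)"
    unfolding nf_def by (rule finite_imageI)
  have "card (nf K N) \<le> card (({1..K} \<rightarrow>\<^sub>E {..N}) \<times> {..N})"
    unfolding nf_def by (rule card_image_le[OF fin])
  also have "\<dots> = (N + 1) ^ (K + 1)"
    by (simp add: card_cartesian_product card_PiE)
  finally show "card (nf K N) \<le> (N + 1) ^ (K + 1)" .
qed

lemma count_small_part: "count (mset (small_part K c)) x = (if x \<in> {1..K} then c x else 0)"
  by (induction K) (auto simp: small_part_def)

lemma length_le_weight: "set u \<subseteq> {1..} \<Longrightarrow> length u \<le> weight C u"
  by (induction u) auto

lemma letter_le_weight: "x \<in> set u \<Longrightarrow> x \<le> weight C u"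
  by (induction u) auto

lemma nf_exists:
  assumes "set u \<subseteq> {1..}" "length (filter ((<) K) u) \<le> 1" "weight C u \<le> N"
  obtains v where "v \<in> nf K N" "mset u = mset v"
proof -
  \<comment> \<open>The filtered list has at most one entry, so its sum is that entry, or 0 if there
    is none. Letters above \<open>K\<close> are positive, hence the coding is unambiguous.\<close>
  define b where "b = sum_list (filter ((<) K) u)"
  define c where "c = restrict (count (mset u)) {1..K}"
  have b: "filter ((<) K) u = (if b = 0 then [] else [b])"
  proof (cases "filter ((<) K) u")
    case (Cons x r)
    then have "x \<in> set (filter ((<) K) u)"
      by simp
    then have "0 < x"
      by auto
    with Cons show ?thesis
      using assms(2) by (simp add: b_def)
  qed (simp add: b_def)
  have "b \<in> {..N}"
  proof (cases "b = 0")
    case False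
    then have "b \<in> set (filter ((<) K) u)"
      by (simp add: b)
    then show ?thesis
      using letter_le_weight[of b u C] assms(3) by simp
  qed simp
  \<comment> \<open>All letters are positive, so the length, and with it every multiplicity, is at
    most the weight.\<close>
  moreover have "count (mset u) x \<le> N" for x
    using count_le_length[of u x] length_le_weight[OF assms(1), of C] assms(3)
    by (simp add: count_mset)
  then have "c \<in> {1..K} \<rightarrow>\<^sub>E {..N}"
    by (auto simp: c_def)
  ultimately have "small_part K c @ (if b = 0 then [] else [b]) \<in> nf K N"
    by (auto simp: nf_def intro!: image_eqI[of _ _ "(c, b)"])
  moreover have "mset u = mset (small_part K c @ filter ((<) K) u)"
  proof (rule multiset_eqI)
    fix x
    show "count (mset u) x = count (mset (small_part K c @ filter ((<) K) u)) x"
    proof (cases "x \<in> set u")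
      case True
      then show ?thesis
        using assms(1) by (auto simp: count_small_part c_def)
    next
      case False
      then have "count (mset u) x = 0"
        by simp
      with False show ?thesis
        by (simp add: count_small_part c_def)
    qed
  qed
  ultimately show ?thesis
    using that b by metis
qed

lemma nf_letters: "u \<in> nf K N \<Longrightarrow> set u \<subseteq> {1..}"
  by (auto simp: nf_def small_part_def split: if_splits)

section \<open>Rewriting modulo an ideal that contains a quadratic element\<close>

text \<open>\<open>J\<close> stands for the kernel of a homomorphism on the free algebra over
  \<open>{1..}\<close>; the instances are the kernels of the maps to \<open>UW\<close> and to its
  quotient by \<open>I\<close>. Multipliers are restricted to \<open>free_alg {1..}\<close> because
  the type also contains words with the letter 0.\<close>

locale witt_ideal =
  fixes J :: "(nat monomial \<Rightarrow>\<^sub>0 'k::field_char_0) set"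
  assumes subspace_J: "fa.subspace J"
    and mult_left: "p \<in> free_alg {1..} \<Longrightarrow> q \<in> J \<Longrightarrow> p * q \<in> J"
    and mult_right: "p \<in> free_alg {1..} \<Longrightarrow> q \<in> J \<Longrightarrow> q * p \<in> J"
    and commutator: "1 \<le> i \<Longrightarrow> 1 \<le> j \<Longrightarrow>
      word [i, j] - word [j, i] - scl (of_nat j - of_nat i) (word [i + j]) \<in> J"
begin

text \<open>Membership means being congruent modulo \<open>J\<close> to a combination of words from
  \<open>S\<close>, that is, rewritable into \<open>S\<close>.\<close>

definition red :: "nat list set \<Rightarrow> (nat monomial \<Rightarrow>\<^sub>0 'k) set" where
  "red S = fa.span (J \<union> word ` S)"

lemma subspace_red: "fa.subspace (red S)"
  by (simp add: red_def)

lemma word_red: "u \<in> S \<Longrightarrow> word u \<in> red S"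
  by (auto simp: red_def intro: fa.span_base)

lemma J_red: "p \<in> J \<Longrightarrow> p \<in> red S"
  by (auto simp: red_def intro: fa.span_base)

lemmas red_add = fa.subspace_add[OF subspace_red]
lemmas red_diff = fa.subspace_diff[OF subspace_red]
lemmas red_scale = fa.subspace_scale[OF subspace_red]
lemmas red_sum = fa.subspace_sum[OF subspace_red]
lemmas red_0 = fa.subspace_0[OF subspace_red]

lemma red_trans: "p \<in> red S \<Longrightarrow> (\<And>u. u \<in> S \<Longrightarrow> word u \<in> red S') \<Longrightarrow> p \<in> red S'"
  using fa.span_minimal[of "J \<union> word ` S" "red S'"] subspace_red J_red by (auto simp: red_def)

lemma red_mono: "p \<in> red S \<Longrightarrow> S \<subseteq> S' \<Longrightarrow> p \<in> red S'"
  by (erule red_trans) (auto intro: word_red)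

text \<open>Rewriting may take place inside a longer word, since \<open>J\<close> is stable under
  multiplication from both sides.\<close>

lemma red_mult:
  assumes "p \<in> red S" "set a \<subseteq> {1..}" "set b \<subseteq> {1..}"
    and S': "\<And>u. u \<in> S \<Longrightarrow> a @ u @ b \<in> S'"
  shows "word a * p * word b \<in> red S'"
proof -
  have "fa.subspace {q. word a * q * word b \<in> red S'}"
    by (rule fa.subspaceI)
      (auto simp: distrib_left distrib_right scl_mult_left scl_mult_right red_0 red_add red_scale)
  moreover have "word a * q * word b \<in> red S'" if "q \<in> J" for q
    using that assms by (intro J_red mult_right mult_left) auto
  moreover have "word a * word u * word b \<in> red S'" if "u \<in> S" for u
    using S'[OF that] by (simp add: word_red flip: word_append)
  ultimately have "fa.span (J \<union> word ` S) \<subseteq> {q. word a * q * word b \<in> red S'}"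
    by (intro fa.span_minimal) auto
  then show ?thesis
    using assms by (auto simp: red_def)
qed

lemma red_diff_iff: "p - q \<in> red S \<Longrightarrow> p \<in> red S \<longleftrightarrow> q \<in> red S"
  using red_add[of "p - q" S q] red_diff[of p S "p - q"] by auto

lemma red_diff_trans: "p - q \<in> red S \<Longrightarrow> q - r \<in> red S \<Longrightarrow> p - r \<in> red S"
  using red_add[of "p - q" S "q - r"] by simp

section \<open>Commuting letters up to shorter words\<close>

lemma swap_pair:
  assumes "1 \<le> i" "1 \<le> j" "[i + j] \<in> S"
  shows "word [i, j] - word [j, i] \<in> red S"
  using red_add[OF J_red[OF commutator[OF assms(1,2)]]
      red_scale[OF word_red[OF assms(3)], of "of_nat j - of_nat i"]] by simp

lemma swap:
  assumes "set a \<subseteq> {1..}" "set b \<subseteq> {1..}" "1 \<le> i" "1 \<le> j" "a @ [i + j] @ b \<in> S"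
  shows "word (a @ [i, j] @ b) - word (a @ [j, i] @ b) \<in> red S"
proof -
  have "word [i, j] - word [j, i] \<in> red {[i + j]}"
    using assms by (intro swap_pair) auto
  from red_mult[OF this assms(1,2), of S] assms(5) show ?thesis
    by (simp add: word_append left_diff_distrib right_diff_distrib mult.assoc del: append.simps)
qed

text \<open>The letter \<open>x\<close> passes the letters of \<open>a\<close> one at a time,
  beginning with the last. Each exchange leaves a correction with one letter fewer and no larger
  weight.\<close>

lemma move_to_front:
  assumes "set a \<subseteq> {1..}" "set b \<subseteq> {1..}" "1 \<le> x" "length (a @ x # b) \<le> n" "weight C (a @ x # b) \<le> N"
  shows "word (a @ x # b) - word (x # a @ b) \<in> red (shorter C n N)"
  using assms
proof (induction a arbitrary: b rule: rev_induct)
  case Nil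
  then show ?case by (simp add: red_0)
next
  case (snoc y a)
  have "word (a @ [y, x] @ b) - word (a @ [x, y] @ b) \<in> red (shorter C n N)"
    using snoc.prems by (intro swap) (auto simp: shorter_def)
  moreover have "word (a @ x # (y # b)) - word (x # a @ y # b) \<in> red (shorter C n N)"
    using snoc.prems by (intro snoc.IH) auto
  ultimately show ?case
    using red_diff_trans by fastforce
qed

text \<open>This is the commutativity of the associated graded algebra. The first letter of
  \<open>u\<close> is brought to the front of \<open>v\<close>, and the remaining letters are
  compared by induction.\<close>

lemma permute:
  assumes "mset u = mset v" "set u \<subseteq> {1..}" "length u \<le> n" "weight C u \<le> N"
  shows "word u - word v \<in> red (shorter C n N)"
  using assms
proof (induction u arbitrary: v n N)
  case Nil
  then show ?case by (simp add: red_0)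
next
  case (Cons x u)
  then have "x \<in> set v"
    by (metis list.set_intros(1) set_mset_mset)
  then obtain a b where v: "v = a @ x # b"
    by (auto simp: in_set_conv_decomp)
  with Cons.prems have *: "mset u = mset (a @ b)"
    by simp
  obtain n' where n: "n = Suc n'"
    using Cons.prems by (cases n) auto
  \<comment> \<open>The induction hypothesis is used with the sharp bound \<open>weight C u\<close>,
    which leaves room for \<open>x\<close> in front.\<close>
  have "word u - word (a @ b) \<in> red (shorter C n' (weight C u))"
    using Cons.prems * n by (intro Cons.IH) auto
  then have "word [x] * (word u - word (a @ b)) * word [] \<in> red (shorter C n N)"
    by (rule red_mult) (use Cons.prems n in \<open>auto simp: shorter_def\<close>)
  then have "word (x # u) - word (x # a @ b) \<in> red (shorter C n N)"
    by (simp add: word_Nil right_diff_distrib flip: word_append)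
  moreover have "word v - word (x # a @ b) \<in> red (shorter C n N)"
    unfolding v
  proof (rule move_to_front)
    have "set v \<subseteq> {1..}" "length v \<le> n" "weight C v \<le> N"
      using Cons.prems(2-4)
      unfolding mset_eq_setD[OF Cons.prems(1)] mset_eq_length[OF Cons.prems(1)]
        weight_mset[OF Cons.prems(1)] by auto
    then show "set a \<subseteq> {1..}" "set b \<subseteq> {1..}" "1 \<le> x" "length (a @ x # b) \<le> n"
      "weight C (a @ x # b) \<le> N"
      by (auto simp: v)
  qed
  ultimately have "(word (x # u) - word (x # a @ b)) - (word v - word (x # a @ b)) \<in> red (shorter C n N)"
    by (rule red_diff)
  then show ?case
    by simp
qed

text \<open>Induction on the length and then on the number of letters above \<open>K\<close>. As
  long as two such letters remain, they are moved to the front and rewritten by \<open>quad\<close>;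
  each resulting word is shorter or has fewer letters above \<open>K\<close>.\<close>

lemma reduction:
  assumes quad: "\<And>x y. K < x \<Longrightarrow> K < y \<Longrightarrow> word [x, y] \<in> red (quadratic_nf K C (x + y))"
    and "set u \<subseteq> {1..}" "weight C u \<le> N"
  shows "word u \<in> red (nf K N)"
  using assms(2,3)
proof (induction u rule: wf_induct_rule[OF wf_measures[of "[length, \<lambda>u. length (filter ((<) K) u)]"]])
  case (1 u)
  have IH: "word v \<in> red (nf K N)" if "length v < length u \<or> length v = length u \<and>
      length (filter ((<) K) v) < length (filter ((<) K) u)" "set v \<subseteq> {1..}" "weight C v \<le> N" for v
    using 1 that by auto
  have shorter: "p \<in> red (nf K N)" if "p \<in> red (shorter C (length u) N)" for p
    using that by (rule red_trans) (rule IH, auto simp: shorter_def)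
  have perm: "word u \<in> red (nf K N) \<longleftrightarrow> word v \<in> red (nf K N)" if "mset u = mset v" for v
    using permute[OF that 1(2) order_refl 1(3)] by (intro red_diff_iff shorter)
  show ?case
  proof (cases "length (filter ((<) K) u) \<le> 1")
    case True
    then show ?thesis
      using nf_exists[OF 1(2) True 1(3)] perm word_red by metis
  next
    case False
    then obtain x y r where xyr: "filter ((<) K) u = x # y # r"
      by (cases "filter ((<) K) u" rule: remdups_adj.cases) auto
    have xy: "K < x" "K < y"
      using arg_cong[OF xyr, of set] by auto
    define t where "t = r @ filter (\<lambda>x. \<not> K < x) u"
    have "mset u = mset (filter ((<) K) u) + mset (filter (\<lambda>x. \<not> K < x) u)"
      by (simp only: mset_filter multiset_partition[symmetric])
    then have m: "mset u = mset (x # y # t)"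
      by (simp add: xyr t_def)
    have t: "set t \<subseteq> {1..}" "length u = length t + 2" "weight C u = x + y + 2 * C + weight C t"
      using mset_eq_setD[OF m] 1(2) mset_eq_length[OF m] weight_mset[OF m] by auto
    have "length (filter ((<) K) u) = length (filter ((<) K) t) + 2"
      using m xy by (metis (no_types, lifting) filter.simps(2) length_Cons mset_eq_length mset_filter add_2_eq_Suc')
    note t = t this
    have "word [] * word [x, y] * word t \<in> red ((\<lambda>v. v @ t) ` quadratic_nf K C (x + y))"
      by (rule red_mult[OF quad]) (use xy t in auto)
    then have "word (x # y # t) \<in> red ((\<lambda>v. v @ t) ` quadratic_nf K C (x + y))"
      by (simp add: word_Nil flip: word_append)
    then have "word (x # y # t) \<in> red (nf K N)"
    proof (rule red_trans)
      fix w assume "w \<in> (\<lambda>v. v @ t) ` quadratic_nf K C (x + y)"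
      then obtain v where w: "w = v @ t" and "v \<in> quadratic_nf K C (x + y)"
        by blast
      then consider (quad) a b where "v = [a, b]" "1 \<le> a" "a \<le> K" "1 \<le> b" "a + b \<le> x + y"
        | (lin) "set v \<subseteq> {1..}" "length v \<le> 1" "sum_list v \<le> x + y + C"
        by (auto simp: quadratic_nf_def)
      then show "word w \<in> red (nf K N)"
      proof cases
        \<comment> \<open>\<open>a \<le> K\<close>, so at least one large letter is gone at equal
          length.\<close>
        case quad
        then show ?thesis
          unfolding w using t 1(3) by (intro IH) auto
      next
        \<comment> \<open>The slack \<open>C\<close> and the at most one letter of \<open>v\<close>
          cost at most \<open>2 * C\<close>, which is what the two removed letters contributed
          beyond \<open>x + y\<close>.\<close>
        case lin
        then have "weight C v \<le> x + y + C * 2"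
          unfolding weight_def by (cases v) auto
        then show ?thesis
          unfolding w using lin t 1(3) by (intro IH) auto
      qed
    qed
    then show ?thesis
      using perm[OF m] by simp
  qed
qed

end

section \<open>The adjoint action on words with at most two letters\<close>

context witt_ideal
begin

text \<open>Bracketing with \<open>word [n]\<close> is a derivation that maps \<open>J\<close> into
  itself for \<open>n \<ge> 1\<close>. It turns a single element of \<open>J\<close> into relations
  of arbitrarily high degree.\<close>

definition ad :: "nat \<Rightarrow> (nat monomial \<Rightarrow>\<^sub>0 'k) \<Rightarrow> (nat monomial \<Rightarrow>\<^sub>0 'k)" where
  "ad n p = word [n] * p - p * word [n]"

lemma ad_sum: "ad n (sum f A) = (\<Sum>x\<in>A. ad n (f x))"
  by (simp add: ad_def sum_distrib_left sum_distrib_right sum_subtractf)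

lemma ad_scl: "ad n (scl c p) = scl c (ad n p)"
  by (simp add: ad_def scl_mult_left scl_mult_right fa.scale_right_diff_distrib)

lemma ad_diff: "ad n (p - q) = ad n p - ad n q"
  by (simp add: ad_def algebra_simps)

lemma ad_add: "ad n (p + q) = ad n p + ad n q"
  by (simp add: ad_def algebra_simps)

lemma ad_mult: "ad n (p * q) = ad n p * q + p * ad n q"
  by (simp add: ad_def algebra_simps)

lemma ad_J: "p \<in> J \<Longrightarrow> 1 \<le> n \<Longrightarrow> ad n p \<in> J"
  unfolding ad_def by (intro fa.subspace_diff[OF subspace_J] mult_left mult_right) auto

lemma ad_letter:
  "1 \<le> n \<Longrightarrow> 1 \<le> i \<Longrightarrow> ad n (word [i]) - scl (of_nat i - of_nat n) (word [i + n]) \<in> J"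
  using commutator[of n i] by (simp add: ad_def add.commute flip: word_append)

lemma J_mult_word:
  "p \<in> J \<Longrightarrow> set u \<subseteq> {1..} \<Longrightarrow> p * word u \<in> J"
  "p \<in> J \<Longrightarrow> set u \<subseteq> {1..} \<Longrightarrow> word u * p \<in> J"
  by (auto intro: mult_left mult_right)

lemma J_diff_trans: "p - q \<in> J \<Longrightarrow> q - r \<in> J \<Longrightarrow> p - r \<in> J"
  using fa.subspace_add[OF subspace_J, of "p - q" "q - r"] by simp

lemma ad_pair:
  assumes "1 \<le> n" "1 \<le> i" "1 \<le> j"
  shows "ad n (word [i, j]) - (scl (of_nat i - of_nat n) (word [i + n, j]) +
           scl (of_nat j - of_nat n) (word [i, j + n])) \<in> J"
proof -
  have "(ad n (word [i]) - scl (of_nat i - of_nat n) (word [i + n])) * word [j] +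
      word [i] * (ad n (word [j]) - scl (of_nat j - of_nat n) (word [j + n])) \<in> J"
    using assms by (intro fa.subspace_add[OF subspace_J] J_mult_word ad_letter) auto
  moreover have "ad n (word [i, j]) = ad n (word [i]) * word [j] + word [i] * ad n (word [j])"
    using ad_mult[of n "word [i]" "word [j]"] by (simp flip: word_append)
  ultimately show ?thesis
    by (simp add: left_diff_distrib right_diff_distrib scl_mult_left scl_mult_right
        algebra_simps flip: word_append)
qed

lemma ad_ad_letter:
  assumes "1 \<le> n" "1 \<le> m" "1 \<le> i" "[i + n + m] \<in> S"
  shows "ad m (ad n (word [i])) \<in> red S"
proof -
  have "ad m (ad n (word [i])) - scl (of_nat i - of_nat n) (ad m (word [i + n])) \<in> J"
    using ad_J[OF ad_letter, of n i m] assms by (simp add: ad_diff ad_scl)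
  moreover have "ad m (word [i + n]) \<in> red S"
    using red_diff_iff[OF J_red[OF ad_letter[of m "i + n"]], of S] assms
    by (simp add: red_scale word_red)
  ultimately show ?thesis
    using red_diff_iff[OF J_red] red_scale by blast
qed

lemma quadratic_nf_swap:
  assumes "1 \<le> a" "1 \<le> b" "a + b \<le> D"
  shows "word [a, b] \<in> red (quadratic_nf K C D) \<longleftrightarrow> word [b, a] \<in> red (quadratic_nf K C D)"
  using assms by (intro red_diff_iff swap_pair) (auto simp: quadratic_nf_def)

text \<open>The small letter may stand in either place, because exchanging the two letters costs
  only a linear term of degree at most \<open>D\<close>.\<close>

lemma quadratic_nf_small:
  assumes "1 \<le> a" "1 \<le> b" "a + b \<le> D" "a \<le> K \<or> b \<le> K"
  shows "word [a, b] \<in> red (quadratic_nf K C D)"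
proof -
  have "word [a, b] \<in> red (quadratic_nf K C D)" if "1 \<le> a" "1 \<le> b" "a + b \<le> D" "a \<le> K" for a b
    using that by (intro word_red) (auto simp: quadratic_nf_def)
  from this[of a b] this[of b a] show ?thesis
    using assms quadratic_nf_swap[OF assms(1-3)] by (auto simp: add.commute)
qed

text \<open>The Leibniz rule gives four words. Those in which \<open>n\<close> and \<open>m\<close>
  fall on the same letter keep the other letter, which is at most \<open>K\<close>, and are
  absorbed. The letters of the first remaining word are ordered so that it becomes
  \<open>[x, y]\<close> for the later choice of \<open>n\<close> and \<open>m\<close>.\<close>

lemma ad_ad_pair:
  assumes "1 \<le> n" "1 \<le> m" "1 \<le> i" "1 \<le> j" "i \<le> K" "j \<le> K" "i + j + n + m \<le> D"
  shows "ad m (ad n (word [i, j])) -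
      (scl ((of_nat j - of_nat n) * (of_nat i - of_nat m)) (word [j + n, i + m]) +
       scl ((of_nat i - of_nat n) * (of_nat j - of_nat m)) (word [i + n, j + m])) \<in>
    red (quadratic_nf K C D)"
    (is "_ - (?s + ?t) \<in> ?R")
proof -
  define a b c e g h :: 'k where "a = of_nat i - of_nat n" and "b = of_nat j - of_nat n"
    and "c = of_nat i - of_nat m" and "e = of_nat j - of_nat m"
    and "g = of_nat (i + n) - of_nat m" and "h = of_nat (j + n) - of_nat m"
  note defs = this
  define q where "q = scl a (word [i + n, j]) + scl b (word [i, j + n])"
  define r where "r =
    scl a (scl g (word [i + n + m, j]) + scl e (word [i + n, j + m])) +
    scl b (scl c (word [i + m, j + n]) + scl h (word [i, j + n + m]))"
  have "ad m (ad n (word [i, j]) - q) \<in> J"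
    unfolding q_def a_def b_def using assms by (intro ad_J ad_pair) auto
  then have 1: "ad m (ad n (word [i, j])) - ad m q \<in> J"
    by (simp add: ad_diff)
  have "scl a (ad m (word [i + n, j]) - (scl g (word [i + n + m, j]) + scl e (word [i + n, j + m]))) +
      scl b (ad m (word [i, j + n]) - (scl c (word [i + m, j + n]) + scl h (word [i, j + n + m]))) \<in> J"
    unfolding c_def e_def g_def h_def using assms
    by (intro fa.subspace_add[OF subspace_J] fa.subspace_scale[OF subspace_J] ad_pair) auto
  then have "ad m q - r \<in> J"
    by (simp only: q_def r_def ad_add ad_scl add_diff_add fa.scale_right_diff_distrib)
  with 1 have 2: "ad m (ad n (word [i, j])) - r \<in> ?R"
    using J_diff_trans J_red by blast
  have "scl a (scl g (word [i + n + m, j])) + scl b (scl h (word [i, j + n + m])) +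
      scl (b * c) (word [i + m, j + n] - word [j + n, i + m]) \<in> ?R"
    using assms by (intro red_add red_scale quadratic_nf_small swap_pair) (auto simp: quadratic_nf_def)
  then have "r - (scl (b * c) (word [j + n, i + m]) + scl (a * e) (word [i + n, j + m])) \<in> ?R"
    by (simp add: r_def algebra_simps)
  with 2 have "ad m (ad n (word [i, j])) -
      (scl (b * c) (word [j + n, i + m]) + scl (a * e) (word [i + n, j + m])) \<in> ?R"
    by (rule red_diff_trans)
  then show ?thesis
    by (simp add: defs)
qed

lemma quadratic_reduction:
  assumes p: "p \<in> J"
    and keys: "\<And>w. w \<in> Poly_Mapping.keys p \<Longrightarrow> set (letters w) \<subseteq> {1..B} \<and> length (letters w) \<le> 2"
    and ordered: "\<And>i j. Monomial [i, j] \<in> Poly_Mapping.keys p \<Longrightarrow> i \<le> j"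
    and quadratic: "Monomial [i0, j0] \<in> Poly_Mapping.keys p"
    and "1 \<le> x" "1 \<le> y"
  shows "word [x, y] \<in> red (quadratic_nf (2 * B) B (x + y))"
proof -
  define P where "P = {(i, j). Monomial [i, j] \<in> Poly_Mapping.keys p}"
  have "P \<subseteq> {1..B} \<times> {1..B}"
    using keys by (force simp: P_def)
  then have fin: "finite P"
    using finite_subset by blast
  \<comment> \<open>The pair \<open>(i1, j1)\<close> chosen below has the largest degree
    \<open>d\<close> among the quadratic words of \<open>p\<close> and, within that degree, the
    largest second letter.\<close>
  define d where "d = Max ((\<lambda>(i, j). i + j) ` P)"
  have "d \<in> (\<lambda>(i, j). i + j) ` P"
    unfolding d_def using fin quadratic by (intro Max_in) (auto simp: P_def)
  moreover have d_max: "i + j \<le> d" if "(i, j) \<in> P" for i j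
    unfolding d_def using fin that by (intro Max_ge) force+
  ultimately have Q: "finite {j. \<exists>i. (i, j) \<in> P \<and> i + j = d}" "{j. \<exists>i. (i, j) \<in> P \<and> i + j = d} \<noteq> {}"
    using finite_surj[OF fin, of "{j. \<exists>i. (i, j) \<in> P \<and> i + j = d}" snd] by force+
  define j1 where "j1 = Max {j. \<exists>i. (i, j) \<in> P \<and> i + j = d}"
  obtain i1 where ij1: "(i1, j1) \<in> P" "i1 + j1 = d"
    using Max_in[OF Q] by (auto simp: j1_def)
  have j1_max: "j \<le> j1" if "(i, j) \<in> P" "i + j = d" for i j
    unfolding j1_def using Q that by (intro Max_ge) auto
  have P: "1 \<le> i" "i \<le> j" "j \<le> B" if "(i, j) \<in> P" for i j
    using that ordered keys[of "Monomial [i, j]"] by (auto simp: P_def)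
  show ?thesis
    using assms(5,6)
  proof (induction "(x, y)" arbitrary: x y rule: wf_induct_rule[OF wf_measures[of "[\<lambda>(x, y). x + y, fst]"]])
    case (1 x y)
    let ?D = "x + y" and ?R = "red (quadratic_nf (2 * B) B (x + y))"
    \<comment> \<open>\<open>quadratic_nf\<close> grows with its degree bound, so results in smaller
      degree remain valid in \<open>?R\<close>; in equal degree the first letter decides.\<close>
    have IH: "word [a, b] \<in> ?R" if "1 \<le> a" "1 \<le> b" "a + b < ?D \<or> a + b = ?D \<and> a < x" for a b
    proof -
      have "word [a, b] \<in> red (quadratic_nf (2 * B) B (a + b))"
        using that by (intro 1) auto
      then show ?thesis
        by (rule red_mono) (use that in \<open>auto simp: quadratic_nf_def\<close>)
    qed
    show ?case
    proof (cases "x \<le> 2 * B \<or> y \<le> 2 * B")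
      case True
      with 1(2,3) show ?thesis
        by (intro quadratic_nf_small) auto
    next
      case False
      \<comment> \<open>\<open>ad m (ad n p)\<close> then has degree \<open>x + y\<close>, and its leading word comes from \<open>[i1, j1]\<close> alone.\<close>
      define n where "n = x - j1"
      define m where "m = y - i1"
      note B = P[OF ij1(1)]
      \<comment> \<open>\<open>x\<close> and \<open>y\<close> exceed \<open>2 * B\<close> while
        \<open>i1, j1 \<le> B\<close>, so \<open>n\<close> and \<open>m\<close> exceed
        \<open>B\<close> and no factor of the leading coefficient \<open>s\<close> vanishes in
        characteristic zero.\<close>
      have nm: "1 \<le> n" "1 \<le> m" "j1 < n" "i1 < m" "j1 + n = x" "i1 + m = y" "n + m + d = ?D"
        using False B ij1(2) by (auto simp: n_def m_def)
      define T :: "nat monomial \<Rightarrow> nat monomial \<Rightarrow>\<^sub>0 'k" where "T w = ad m (ad n (word (letters w)))" for w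
      define s t :: 'k where "s = (of_nat j1 - of_nat n) * (of_nat i1 - of_nat m)"
        and "t = (of_nat i1 - of_nat n) * (of_nat j1 - of_nat m)"
      have pair: "T (Monomial [i, j]) -
          (scl ((of_nat j - of_nat n) * (of_nat i - of_nat m)) (word [j + n, i + m]) +
           scl ((of_nat i - of_nat n) * (of_nat j - of_nat m)) (word [i + n, j + m])) \<in> ?R"
        if "(i, j) \<in> P" for i j
        unfolding T_def using nm P[OF that] d_max[OF that]
        by (simp only: monomial.sel, intro ad_ad_pair) auto
      have other: "T w \<in> ?R" if w: "w \<in> Poly_Mapping.keys p" "w \<noteq> Monomial [i1, j1]" for w
      proof -
        consider "w = Monomial []" | i where "w = Monomial [i]" | i j where "w = Monomial [i, j]"
          using keys[OF w(1)]
          by (cases w rule: monomial.exhaust) (auto simp: numeral_2_eq_2 le_Suc_eq length_Suc_conv)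
        then show ?thesis
        proof cases
          case 1
          then show ?thesis
            by (simp add: T_def ad_def word_Nil red_0)
        next
          case (2 i)
          then have "1 \<le> i" "i \<le> B"
            using keys[OF w(1)] by auto
          \<comment> \<open>Here the slack is used: \<open>i\<close> may be larger than
            \<open>d\<close>, but \<open>i + n + m \<le> x + y + B\<close>.\<close>
          then have "ad m (ad n (word [i])) \<in> ?R"
            using nm by (intro ad_ad_letter) (auto simp: quadratic_nf_def)
          with 2 show ?thesis
            by (simp add: T_def)
        next
          case (3 i j)
          then have ij: "(i, j) \<in> P"
            using w(1) by (simp add: P_def)
          \<comment> \<open>In degree \<open>d\<close>, the equality \<open>j = j1\<close> would
            force \<open>i = i1\<close>.\<close>
          have lt: "i + j < d \<or> i + j = d \<and> j < j1"
            using d_max[OF ij] j1_max[OF ij] w(2) 3 ij1(2) by (cases "j = j1") auto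
          \<comment> \<open>In degree \<open>d\<close>, \<open>i \<le> j < j1\<close> makes both
            first letters \<open>j + n\<close> and \<open>i + n\<close> smaller than
            \<open>x = j1 + n\<close>; otherwise the degree is below \<open>x + y\<close>.\<close>
          have "word [j + n, i + m] \<in> ?R" "word [i + n, j + m] \<in> ?R"
            using P[OF ij] lt nm by (intro IH; linarith)+
          then show ?thesis
            unfolding 3 using red_diff_iff[OF pair[OF ij]] red_add red_scale by blast
        qed
      qed
      let ?w = "Monomial [i1, j1]"
      let ?c = "Poly_Mapping.lookup p ?w"
      have w: "?w \<in> Poly_Mapping.keys p"
        using ij1(1) by (simp add: P_def)
      \<comment> \<open>The element \<open>ad m (ad n p)\<close> of \<open>J\<close> is expanded
        over the words of \<open>p\<close>; by \<open>other\<close>, only the term of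
        \<open>[i1, j1]\<close> is not yet known to be reducible.\<close>
      have "(\<Sum>w\<in>Poly_Mapping.keys p. scl (Poly_Mapping.lookup p w) (T w)) = ad m (ad n p)"
        by (subst (3) sum_words) (simp add: T_def ad_sum ad_scl)
      also have "\<dots> \<in> ?R"
        using nm by (intro J_red ad_J p)
      finally have "scl ?c (T ?w) + (\<Sum>w\<in>Poly_Mapping.keys p - {?w}. scl (Poly_Mapping.lookup p w) (T w)) \<in> ?R"
        by (subst (asm) sum.remove[OF finite_keys w])
      moreover have "(\<Sum>w\<in>Poly_Mapping.keys p - {?w}. scl (Poly_Mapping.lookup p w) (T w)) \<in> ?R"
        by (intro red_sum red_scale other) auto
      ultimately have "scl ?c (T ?w) \<in> ?R"
        using red_diff by fastforce
      from red_scale[OF this, of "inverse ?c"] have "T ?w \<in> ?R"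
        using w by (simp add: in_keys_iff)
      then have st: "scl s (word [x, y]) + scl t (word [i1 + n, j1 + m]) \<in> ?R"
        using red_diff_iff[OF pair[OF ij1(1)]] nm by (simp add: s_def t_def)
      have "s \<noteq> 0"
        using nm by (simp add: s_def)
      \<comment> \<open>For \<open>i1 = j1\<close> both words are \<open>[x, y]\<close> and the
        coefficients add up to \<open>2 * s\<close>. Otherwise \<open>i1 < j1\<close>, and the
        second word has the smaller first letter \<open>i1 + n\<close>.\<close>
      have "\<exists>c. c \<noteq> 0 \<and> scl c (word [x, y]) \<in> ?R"
      proof (cases "i1 = j1")
        case True
        then have "t = s" "[i1 + n, j1 + m] = [x, y]"
          using nm by (auto simp: s_def t_def)
        then have "scl (s + s) (word [x, y]) \<in> ?R"
          using st by (simp only: fa.scale_left_distrib)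
        moreover have "s + s \<noteq> 0"
          using \<open>s \<noteq> 0\<close> by (simp flip: mult_2)
        ultimately show ?thesis
          by blast
      next
        case False
        then have *: "word [i1 + n, j1 + m] \<in> ?R"
          using B ij1(2) nm by (intro IH; linarith)
        have "scl s (word [x, y]) \<in> ?R"
          using red_diff[OF st red_scale[OF *, of t]] by simp
        with \<open>s \<noteq> 0\<close> show ?thesis
          by blast
      qed
      then obtain c where "c \<noteq> 0" "scl c (word [x, y]) \<in> ?R"
        by blast
      from red_scale[OF this(2), of "inverse c"] this(1) show ?thesis
        by simp
    qed
  qed
qed

end

section \<open>From an element of order at most 2 to a quadratic one\<close>

lemma keys_span_words:
  fixes p :: "'i monomial \<Rightarrow>\<^sub>0 'k::field"
  assumes "p \<in> fa.span (word ` S)" "w \<in> Poly_Mapping.keys p"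
  shows "letters w \<in> S"
proof -
  have "fa.span (word ` S) \<subseteq> {p :: 'i monomial \<Rightarrow>\<^sub>0 'k. \<forall>w\<in>Poly_Mapping.keys p. letters w \<in> S}"
    by (intro fa.span_minimal subspace_supported) (auto simp: word_def)
  then show ?thesis
    using assms by blast
qed

text \<open>Prefixing a fixed word is injective on words, so left multiplication by it cannot cancel
  terms.\<close>

lemma lookup_word_mult: "Poly_Mapping.lookup (word v * p) (Monomial (v @ u)) = Poly_Mapping.lookup p (Monomial u)"
proof -
  have "word v * p = (\<Sum>w\<in>Poly_Mapping.keys p. scl (Poly_Mapping.lookup p w) (word (v @ letters w)))"
    by (subst sum_words[of p]) (simp add: sum_distrib_left scl_mult_right word_append)
  also have "Poly_Mapping.lookup \<dots> (Monomial (v @ u)) =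
      (\<Sum>w\<in>Poly_Mapping.keys p. if w = Monomial u then Poly_Mapping.lookup p w else 0)"
    unfolding lookup_sum
    by (intro sum.cong) (auto simp: word_def lookup_single when_def monomial.expand)
  also have "\<dots> = Poly_Mapping.lookup p (Monomial u)"
    by (simp add: in_keys_iff)
  finally show ?thesis .
qed

text \<open>Sorting gives every quadratic word \<open>[i, j]\<close> the property
  \<open>i \<le> j\<close> that \<open>quadratic_reduction\<close> demands.\<close>

definition short_sorted :: "nat list set" where
  "short_sorted = {u. set u \<subseteq> {1..} \<and> length u \<le> 2 \<and> sorted u}"

context witt_ideal
begin

lemma sort_short_word:
  assumes "set u \<subseteq> {1..}" "length u \<le> 2"
  shows "word u \<in> red short_sorted"
proof -
  have "u \<in> short_sorted \<or> (\<exists>i j. u = [i, j] \<and> j < i)"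
    using assms by (auto simp: short_sorted_def numeral_2_eq_2 le_Suc_eq length_Suc_conv not_le)
  then consider "u \<in> short_sorted" | i j where "u = [i, j]" "j < i"
    by blast
  then show ?thesis
  proof cases
    case 1
    then show ?thesis by (rule word_red)
  next
    case (2 i j)
    then have "word [i, j] - word [j, i] \<in> red short_sorted"
      using assms by (intro swap_pair) (auto simp: short_sorted_def)
    moreover have "word [j, i] \<in> red short_sorted"
      using 2 assms by (intro word_red) (auto simp: short_sorted_def)
    ultimately show ?thesis
      using 2 red_diff_iff by blast
  qed
qed

lemma red_decompose:
  assumes "p \<in> red S"
  obtains q where "q \<in> fa.span (word ` S)" "p - q \<in> J"
proof -
  have "fa.span J = J"
    using subspace_J fa.span_eq_iff by blast
  with assms obtain x y where "x \<in> J" "y \<in> fa.span (word ` S)" "p = x + y"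
    by (auto simp only: red_def fa.span_Un)
  then show ?thesis
    using that[of y] by simp
qed

lemma normal_forms:
  assumes p: "p \<in> J" "p \<noteq> 0" and keys: "\<And>w. w \<in> Poly_Mapping.keys p \<Longrightarrow> letters w \<in> short_sorted"
  obtains K C where "\<And>u N. set u \<subseteq> {1..} \<Longrightarrow> weight C u \<le> N \<Longrightarrow> word u \<in> red (nf K N)"
proof -
  define M where "M = Max ((\<lambda>w. length (letters w)) ` Poly_Mapping.keys p)"
  have "M \<in> (\<lambda>w. length (letters w)) ` Poly_Mapping.keys p"
    unfolding M_def using p by (intro Max_in) auto
  then obtain w where w: "w \<in> Poly_Mapping.keys p" "M = length (letters w)"
    by blast
  have w_max: "length (letters w') \<le> length (letters w)" if "w' \<in> Poly_Mapping.keys p" for w'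
    unfolding w(2)[symmetric] M_def using that by (intro Max_ge) auto
  \<comment> \<open>Multiplication by a power of \<open>e\<^sub>1\<close> turns the longest words of \<open>p\<close> into words of length 2.\<close>
  define v where "v = replicate (2 - length (letters w)) (1 :: nat)"
  define q where "q = word v * p"
  have w2: "length (letters w) \<le> 2"
    using keys[OF w(1)] by (simp add: short_sorted_def)
  have "q \<in> J"
    unfolding q_def using p by (intro mult_left) (auto simp: v_def)
  have q_keys: "letters x \<in> short_sorted" if x: "x \<in> Poly_Mapping.keys q" for x
  proof -
    obtain y where y: "y \<in> Poly_Mapping.keys p" "x = Monomial (v @ letters y)"
      using x keys_mult[of "word v" p] by (auto simp: q_def word_def plus_monomial_def)
    \<comment> \<open>Prefixing ones keeps a word sorted because 1 is the smallest letter, and the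
      length stays at most 2 because \<open>letters w\<close> is a longest word.\<close>
    then show ?thesis
      using keys[OF y(1)] w_max[OF y(1)] w2
      by (auto simp: short_sorted_def v_def sorted_append)
  qed
  have "\<exists>i j. u = [i, j]" if "length u = 2" for u :: "nat list"
    using that by (auto simp: numeral_2_eq_2 length_Suc_conv)
  moreover have "length (v @ letters w) = 2"
    using w2 by (simp add: v_def)
  ultimately obtain i j where ij: "v @ letters w = [i, j]"
    by blast
  have "Poly_Mapping.lookup q (Monomial (v @ letters w)) \<noteq> 0"
    unfolding q_def lookup_word_mult using w(1) by (simp add: in_keys_iff)
  then have ij_key: "Monomial [i, j] \<in> Poly_Mapping.keys q"
    by (simp add: ij in_keys_iff)
  have "finite (\<Union>x\<in>Poly_Mapping.keys q. set (letters x))"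
    by simp
  then obtain B where B: "\<And>x y. x \<in> Poly_Mapping.keys q \<Longrightarrow> y \<in> set (letters x) \<Longrightarrow> y \<le> B"
    unfolding finite_nat_set_iff_bounded_le by blast
  have quad: "word [x, y] \<in> red (quadratic_nf (2 * B) B (x + y))" if "1 \<le> x" "1 \<le> y" for x y
  proof (rule quadratic_reduction[OF \<open>q \<in> J\<close> _ _ ij_key that])
    fix x assume "x \<in> Poly_Mapping.keys q"
    then show "set (letters x) \<subseteq> {1..B} \<and> length (letters x) \<le> 2"
      using q_keys[of x] B[of x] by (auto simp: short_sorted_def)
  next
    fix i j assume "Monomial [i, j] \<in> Poly_Mapping.keys q"
    then show "i \<le> j"
      using q_keys[of "Monomial [i, j]"] by (simp add: short_sorted_def)
  qed
  show ?thesis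
  proof (rule that[of B "2 * B"])
    fix u N assume "set u \<subseteq> {1..}" "weight B u \<le> N"
    then show "word u \<in> red (nf (2 * B) N)"
      by (intro reduction[where C = B] quad) auto
  qed
qed

end

section \<open>Quotient algebras and their Gelfand-Kirillov dimension\<close>

text \<open>By the replacement theorem every independent subset of \<open>W\<close> has at most
  \<open>card X\<close> elements. Hence a maximal one exists, and it is a basis of
  \<open>W\<close>.\<close>

lemma (in vectorspace) dim_subspace_le:
  assumes W: "subspace K W V" and X: "finite X" "X \<subseteq> carrier V" "W \<subseteq> span X"
  shows "vectorspace.dim K (vs W) \<le> card X"
proof -
  interpret w: vectorspace K "vs W"
    by (rule subspace_is_vs[OF W])
  have sub: "submodule K W V"
    by (rule is_module[OF W])
  let ?indpt = "\<lambda>S. S \<subseteq> carrier (vs W) \<and> w.lin_indpt S"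
  have bound: "finite S \<and> card S \<le> card X" if "?indpt S" for S
  proof -
    have S: "S \<subseteq> W" "lin_indpt S"
      using that span_li_not_depend(2)[OF _ sub, of S] by auto
    have fin: "card T \<le> card X" if T: "finite T" "T \<subseteq> S" for T
    proof -
      have "lin_indpt T"
        by (rule subset_li_is_li[OF S(2) T(2)])
      moreover have "T \<subseteq> span X"
        using T S X by blast
      ultimately show ?thesis
        using replacement[OF T(1) X(1,2)] by force
    qed
    have "finite S"
    proof (rule ccontr)
      assume "infinite S"
      from infinite_arbitrarily_large[OF this, of "Suc (card X)"]
      obtain T where "finite T" "card T = Suc (card X)" "T \<subseteq> S"
        by blast
      with fin[of T] show False
        by simp
    qed
    with fin[of S] show ?thesis by simp
  qed
  have "?indpt {}"
    by (simp add: w.lin_dep_def)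
  from maximal_exists[of ?indpt, OF bound this]
  obtain A where A: "finite A" "maximal A ?indpt"
    by blast
  then have basis: "w.basis A"
    by (intro w.max_li_is_basis)
  then have "?indpt A"
    by (simp add: w.basis_def)
  with w.dim_basis[OF A(1) basis] bound[of A] show ?thesis
    by simp
qed

section \<open>Algebras over a field and their quotients\<close>

locale assoc_algebra = ring A + V: vectorspace "class_ring :: 'k ring" A
  for A :: "('k::field, 'a, 'm) module_scheme" (structure) +
  assumes smult_mult_left: "a \<in> carrier A \<Longrightarrow> b \<in> carrier A \<Longrightarrow> (c \<odot> a) \<otimes> b = c \<odot> (a \<otimes> b)"
    and smult_mult_right: "a \<in> carrier A \<Longrightarrow> b \<in> carrier A \<Longrightarrow> a \<otimes> (c \<odot> b) = c \<odot> (a \<otimes> b)"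
begin

lemma smult_closed' [simp]: "a \<in> carrier A \<Longrightarrow> c \<odot> a \<in> carrier A"
  by (rule V.smult_closed) auto

lemma smult_r_distr': "a \<in> carrier A \<Longrightarrow> b \<in> carrier A \<Longrightarrow> c \<odot> (a \<oplus> b) = c \<odot> a \<oplus> c \<odot> b"
  by (rule V.smult_r_distr) auto

lemma smult_l_distr': "a \<in> carrier A \<Longrightarrow> (c + d) \<odot> a = c \<odot> a \<oplus> d \<odot> a"
  using V.smult_l_distr[of c d a] by simp

lemma smult_assoc': "a \<in> carrier A \<Longrightarrow> (c * d) \<odot> a = c \<odot> (d \<odot> a)"
  using V.smult_assoc1[of c d a] by simp

lemma smult_one': "a \<in> carrier A \<Longrightarrow> 1 \<odot> a = a"
  using V.smult_one[of a] by simp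

text \<open>A ring ideal absorbs scalars because \<open>c \<odot> x\<close> is the product of
  \<open>c \<odot> \<one>\<close> and \<open>x\<close>.\<close>

lemma ideal_smult:
  assumes "ideal I A" "x \<in> I"
  shows "c \<odot> x \<in> I"
proof -
  interpret ideal I A by fact
  have x: "x \<in> carrier A"
    using assms a_subset by auto
  then have "(c \<odot> \<one>) \<otimes> x \<in> I"
    using assms by (intro I_l_closed) auto
  with x show ?thesis
    by (simp add: smult_mult_left)
qed

end

lemma quot_algebra_simps:
  "carrier (quot_algebra A I) = a_rcosets\<^bsub>A\<^esub> I"
  "mult (quot_algebra A I) = rcoset_mult A I"
  "one (quot_algebra A I) = I +>\<^bsub>A\<^esub> \<one>\<^bsub>A\<^esub>"
  "zero (quot_algebra A I) = I"
  "add (quot_algebra A I) = set_add A"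
  "smult (quot_algebra A I) = (\<lambda>c X. \<Union>x\<in>X. I +>\<^bsub>A\<^esub> (c \<odot>\<^bsub>A\<^esub> x))"
  by (simp_all add: quot_algebra_def ring.defs module.defs FactRing_def)

context assoc_algebra
begin

context
  fixes I
  assumes I: "ideal I A"
begin

interpretation ideal I A by (rule I)

lemma quot_carrier: "carrier (quot_algebra A I) = (\<lambda>x. I +> x) ` carrier A"
  by (auto simp: quot_algebra_simps A_RCOSETS_def' )

lemma quot_add: "x \<in> carrier A \<Longrightarrow> y \<in> carrier A \<Longrightarrow> (I +> x) \<oplus>\<^bsub>quot_algebra A I\<^esub> (I +> y) = I +> (x \<oplus> y)"
  by (simp add: quot_algebra_simps a_rcos_sum)

lemma quot_mult: "x \<in> carrier A \<Longrightarrow> y \<in> carrier A \<Longrightarrow> (I +> x) \<otimes>\<^bsub>quot_algebra A I\<^esub> (I +> y) = I +> (x \<otimes> y)"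
  by (simp add: quot_algebra_simps rcoset_mult_add)

lemma quot_one: "\<one>\<^bsub>quot_algebra A I\<^esub> = I +> \<one>"
  by (simp add: quot_algebra_simps)

lemma quot_zero: "\<zero>\<^bsub>quot_algebra A I\<^esub> = I +> \<zero>"
  by (simp only: quot_algebra_simps) (rule a_rcos_const[symmetric], simp)

text \<open>The union in \<open>quot_algebra\<close> runs over equal cosets: changing the
  representative by \<open>i \<in> I\<close> changes \<open>c \<odot> x\<close> by
  \<open>c \<odot> i\<close>, which lies in \<open>I\<close>.\<close>

lemma quot_smult:
  assumes "x \<in> carrier A"
  shows "c \<odot>\<^bsub>quot_algebra A I\<^esub> (I +> x) = I +> (c \<odot> x)"
proof -
  have "I +> (c \<odot> y) = I +> (c \<odot> x)" if y: "y \<in> I +> x" for y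
  proof -
    obtain i where i: "i \<in> I" "y = i \<oplus> x"
      using y by (auto simp: a_r_coset_def')
    then have "c \<odot> y = c \<odot> i \<oplus> c \<odot> x"
      using assms a_subset by (auto intro: smult_r_distr')
    then have "c \<odot> y \<in> I +> (c \<odot> x)"
      using ideal_smult[OF I i(1)] by (auto simp: a_r_coset_def')
    then show ?thesis
      by (intro a_repr_independence'[symmetric]) (use assms in simp_all)
  qed
  moreover have "x \<in> I +> x"
    using assms by (rule a_rcos_self)
  ultimately show ?thesis
    unfolding quot_algebra_simps by blast
qed

lemma quot_cases:
  assumes "X \<in> carrier (quot_algebra A I)"
  obtains x where "x \<in> carrier A" "X = I +> x"
  using assms by (auto simp: quot_carrier)

lemma abelian_group_quot: "abelian_group (quot_algebra A I)" (is "abelian_group ?Q")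
proof (rule abelian_groupI; (elim quot_cases)?; hypsubst?)
  fix a assume "a \<in> carrier A"
  then show "\<exists>y\<in>carrier ?Q. y \<oplus>\<^bsub>?Q\<^esub> (I +> a) = \<zero>\<^bsub>?Q\<^esub>"
    by (intro bexI[of _ "I +> (\<ominus> a)"]) (simp_all add: quot_add quot_zero quot_carrier l_neg)
next
  fix a b c assume "a \<in> carrier A" "b \<in> carrier A" "c \<in> carrier A"
  then show "(I +> a) \<oplus>\<^bsub>?Q\<^esub> (I +> b) \<oplus>\<^bsub>?Q\<^esub> (I +> c) = (I +> a) \<oplus>\<^bsub>?Q\<^esub> ((I +> b) \<oplus>\<^bsub>?Q\<^esub> (I +> c))"
    by (simp add: quot_add a_assoc)
next
  fix a b assume "a \<in> carrier A" "b \<in> carrier A"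
  then show "(I +> a) \<oplus>\<^bsub>?Q\<^esub> (I +> b) = (I +> b) \<oplus>\<^bsub>?Q\<^esub> (I +> a)"
    by (simp add: quot_add a_comm)
qed (simp_all add: quot_add quot_zero quot_carrier)

lemma ring_quot: "ring (quot_algebra A I)"
proof (rule ringI)
  show "Group.monoid (quot_algebra A I)"
    by (rule monoidI; (elim quot_cases)?; hypsubst?)
      (simp_all add: quot_mult quot_one quot_carrier m_assoc)
qed (rule abelian_group_quot, (elim quot_cases, hypsubst, simp add: quot_add quot_mult l_distr r_distr)+)

lemma assoc_algebra_quot: "assoc_algebra (quot_algebra A I)"
proof -
  have "module (class_ring :: 'k ring) (quot_algebra A I)"
  proof (rule moduleI)
    show "cring (class_ring :: 'k ring)"
      by (rule fieldE(1)[OF class_field])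
  qed (rule abelian_group_quot, (elim quot_cases, hypsubst, simp add: quot_add quot_smult quot_carrier
      smult_r_distr' smult_l_distr' smult_assoc' smult_one')+)
  then have "vectorspace (class_ring :: 'k ring) (quot_algebra A I)"
    by (simp add: vectorspace_def class_field)
  then show ?thesis
    by (intro assoc_algebra.intro assoc_algebra_axioms.intro ring_quot)
      (assumption | elim quot_cases, hypsubst, simp add: quot_mult quot_smult smult_mult_left smult_mult_right)+
qed

end

end

section \<open>Algebras presented as images of a free algebra\<close>

locale presentation = assoc_algebra A
  for A :: "('k::field, 'a, 'm) module_scheme" (structure) +
  fixes \<phi> :: "('i monomial \<Rightarrow>\<^sub>0 'k) \<Rightarrow> 'a" and L :: "'i set"
  assumes image: "\<phi> ` free_alg L = carrier A"
    and hom_add: "p \<in> free_alg L \<Longrightarrow> q \<in> free_alg L \<Longrightarrow> \<phi> (p + q) = \<phi> p \<oplus> \<phi> q"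
    and hom_mult: "p \<in> free_alg L \<Longrightarrow> q \<in> free_alg L \<Longrightarrow> \<phi> (p * q) = \<phi> p \<otimes> \<phi> q"
    and hom_scl: "p \<in> free_alg L \<Longrightarrow> \<phi> (scl c p) = c \<odot> \<phi> p"
    and hom_one: "\<phi> 1 = \<one>"
begin

lemma hom_closed [simp]: "p \<in> free_alg L \<Longrightarrow> \<phi> p \<in> carrier A"
  using image by blast

lemmas free_alg_add = fa.subspace_add[OF subspace_free_alg[of L]]
lemmas free_alg_scale = fa.subspace_scale[OF subspace_free_alg[of L]]
lemmas free_alg_diff = fa.subspace_diff[OF subspace_free_alg[of L]]
lemmas free_alg_0 = fa.subspace_0[OF subspace_free_alg[of L]]

lemma hom_zero: "\<phi> 0 = \<zero>"
  using hom_scl[of 0 0] V.lmult_0[of "\<phi> 0"] free_alg_0 by simp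

lemma hom_diff: "p \<in> free_alg L \<Longrightarrow> q \<in> free_alg L \<Longrightarrow> \<phi> (p - q) \<oplus> \<phi> q = \<phi> p"
  using hom_add[OF free_alg_diff[of p q], of q] by simp

lemma span_subset_free_alg: "X \<subseteq> free_alg L \<Longrightarrow> fa.span X \<subseteq> free_alg L"
  by (rule fa.span_minimal[OF _ subspace_free_alg])

lemma submodule_image:
  assumes "fa.subspace W" "W \<subseteq> free_alg L"
  shows "submodule (class_ring :: 'k ring) (\<phi> ` W) A"
proof (rule submodule.intro)
  show "module (class_ring :: 'k ring) A"
    by (rule V.module_axioms)
  show "\<phi> ` W \<subseteq> carrier A"
    using assms by auto
  show "\<zero> \<in> \<phi> ` W"
    using fa.subspace_0[OF assms(1)] hom_zero by force
next
  fix v w assume "v \<in> \<phi> ` W" "w \<in> \<phi> ` W"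
  then obtain p q where "p \<in> W" "q \<in> W" "v = \<phi> p" "w = \<phi> q"
    by blast
  moreover from this have "v \<oplus> w = \<phi> (p + q)"
    using subsetD[OF assms(2)] by (simp add: hom_add)
  ultimately show "v \<oplus> w \<in> \<phi> ` W"
    using fa.subspace_add[OF assms(1)] by blast
next
  fix c :: 'k and v assume "v \<in> \<phi> ` W"
  then obtain p where "p \<in> W" "v = \<phi> p"
    by blast
  moreover from this have "c \<odot> v = \<phi> (scl c p)"
    using subsetD[OF assms(2)] by (simp add: hom_scl)
  ultimately show "c \<odot> v \<in> \<phi> ` W"
    using fa.subspace_scale[OF assms(1)] by blast
qed

text \<open>Links the span in the algebra record with the span in \<open>fa\<close>; each inclusion
  follows from the minimality of a span.\<close>

lemma span_image:
  assumes X: "X \<subseteq> free_alg L"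
  shows "lin_span A (\<phi> ` X) = \<phi> ` fa.span X"
proof
  have sub: "\<phi> ` X \<subseteq> carrier A"
    using X by auto
  show "lin_span A (\<phi> ` X) \<subseteq> \<phi> ` fa.span X"
    using submodule_image[OF fa.subspace_span span_subset_free_alg[OF X]]
    by (rule V.span_is_subset[rotated]) (auto intro: fa.span_base)
  have module: "submodule (class_ring :: 'k ring) (lin_span A (\<phi> ` X)) A"
    by (rule V.span_is_submodule[OF sub])
  have "fa.subspace {p \<in> free_alg L. \<phi> p \<in> lin_span A (\<phi> ` X)}"
    by (rule fa.subspaceI)
      (use submodule.zero_closed[OF module] submodule.m_closed[OF module] submodule.smult_closed[OF module]
        in \<open>auto simp: hom_zero hom_add hom_scl free_alg_0 free_alg_add free_alg_scale\<close>)
  moreover have "X \<subseteq> {p \<in> free_alg L. \<phi> p \<in> lin_span A (\<phi> ` X)}"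
    using X V.in_own_span[OF sub] by auto
  ultimately have "fa.span X \<subseteq> {p \<in> free_alg L. \<phi> p \<in> lin_span A (\<phi> ` X)}"
    by (intro fa.span_minimal)
  then show "\<phi> ` fa.span X \<subseteq> lin_span A (\<phi> ` X)"
    by auto
qed

definition ker :: "('i monomial \<Rightarrow>\<^sub>0 'k) set" where
  "ker = {p \<in> free_alg L. \<phi> p = \<zero>}"

lemma subspace_ker: "fa.subspace ker"
  by (rule fa.subspaceI)
    (auto simp: ker_def hom_zero hom_add hom_scl free_alg_0 free_alg_add free_alg_scale V.rmult_0)

lemma ker_mult_left: "p \<in> free_alg L \<Longrightarrow> q \<in> ker \<Longrightarrow> p * q \<in> ker"
  by (auto simp: ker_def hom_mult mult_in_free_alg)

lemma ker_mult_right: "p \<in> free_alg L \<Longrightarrow> q \<in> ker \<Longrightarrow> q * p \<in> ker"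
  by (auto simp: ker_def hom_mult mult_in_free_alg)

lemma hom_eq_of_ker: "p \<in> free_alg L \<Longrightarrow> q \<in> free_alg L \<Longrightarrow> p - q \<in> ker \<Longrightarrow> \<phi> p = \<phi> q"
  using hom_diff[of p q] by (simp add: ker_def)

lemma image_span_ker:
  assumes X: "X \<subseteq> free_alg L" and p: "p \<in> fa.span (ker \<union> X)"
  shows "\<phi> p \<in> lin_span A (\<phi> ` X)"
proof -
  have "fa.span ker = ker"
    using subspace_ker fa.span_eq_iff by blast
  with p obtain x y where xy: "x \<in> ker" "y \<in> fa.span X" "p = x + y"
    by (auto simp only: fa.span_Un)
  then have "y \<in> free_alg L"
    using span_subset_free_alg[OF X] by blast
  with xy have "\<phi> p = \<phi> y"
    by (simp add: ker_def hom_add)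
  then show ?thesis
    using xy(2) by (simp add: span_image[OF X])
qed

text \<open>The presentation is composed with the projection. Two such steps lead from the tensor
  algebra to \<open>UW\<close> and on to its quotient by \<open>I\<close>.\<close>

lemma presentation_quot:
  assumes I: "ideal I A"
  shows "presentation (quot_algebra A I) (\<lambda>p. I +> \<phi> p) L"
proof (intro presentation.intro presentation_axioms.intro assoc_algebra_quot[OF I])
  show "(\<lambda>p. I +> \<phi> p) ` free_alg L = carrier (quot_algebra A I)"
    by (simp add: quot_carrier[OF I] image_image flip: image)
qed (simp_all add: quot_add[OF I] quot_mult[OF I] quot_smult[OF I] quot_one[OF I] hom_add hom_mult hom_scl hom_one)

end

lemma tensor_algebra_simps:
  "carrier (tensor_algebra S) = free_alg S"
  "mult (tensor_algebra S) = (*)"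
  "one (tensor_algebra S) = 1"
  "zero (tensor_algebra S) = 0"
  "add (tensor_algebra S) = (+)"
  "smult (tensor_algebra S) = scl"
  by (auto simp: tensor_algebra_def free_alg_def scl_def)

lemma one_in_free_alg: "1 \<in> free_alg S"
  using word_in_free_alg[of "[]" S] by (simp add: word_Nil)

lemma presentation_tensor_algebra:
  "presentation (tensor_algebra S :: ('k::field, 'i monomial \<Rightarrow>\<^sub>0 'k) module) (\<lambda>p. p) S"
proof -
  let ?T = "tensor_algebra S :: ('k, 'i monomial \<Rightarrow>\<^sub>0 'k) module"
  note closed = mult_in_free_alg one_in_free_alg fa.subspace_add[OF subspace_free_alg]
    fa.subspace_0[OF subspace_free_alg] fa.subspace_scale[OF subspace_free_alg]
  have grp: "abelian_group ?T"
  proof (rule abelian_groupI)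
    fix p assume "p \<in> carrier ?T"
    then show "\<exists>q\<in>carrier ?T. q \<oplus>\<^bsub>?T\<^esub> p = \<zero>\<^bsub>?T\<^esub>"
      using fa.subspace_neg[OF subspace_free_alg] by (intro bexI[of _ "- p"]) (auto simp: tensor_algebra_simps)
  qed (auto simp: tensor_algebra_simps closed algebra_simps)
  have "ring ?T"
  proof (rule ringI[OF grp])
    show "Group.monoid ?T"
      by (rule monoidI) (auto simp: tensor_algebra_simps closed mult.assoc)
  qed (auto simp: tensor_algebra_simps algebra_simps)
  moreover have "module (class_ring :: 'k ring) ?T"
    by (rule moduleI[OF fieldE(1)[OF class_field] grp])
      (auto simp: tensor_algebra_simps closed fa.scale_left_distrib fa.scale_right_distrib)
  then have "vectorspace (class_ring :: 'k ring) ?T"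
    by (simp add: vectorspace_def class_field)
  ultimately show ?thesis
    by (intro presentation.intro assoc_algebra.intro assoc_algebra_axioms.intro presentation_axioms.intro)
      (auto simp: tensor_algebra_simps scl_mult_left scl_mult_right)
qed

section \<open>Filtrations by words and growth\<close>

context presentation
begin

text \<open>\<open>wt\<close> is left open: \<open>length\<close> gives the order filtration, and
  \<open>weight C\<close> the filtration in which dimensions are counted.\<close>

definition filtration :: "('i list \<Rightarrow> nat) \<Rightarrow> nat \<Rightarrow> 'a set" where
  "filtration wt N = \<phi> ` fa.span (word ` {u. set u \<subseteq> L \<and> wt u \<le> N})"

lemma words_in_free_alg: "word ` {u. set u \<subseteq> L \<and> P u} \<subseteq> free_alg L"
  by auto

lemma filtration_submodule: "submodule (class_ring :: 'k ring) (filtration wt N) A"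
  unfolding filtration_def
  by (intro submodule_image fa.subspace_span span_subset_free_alg words_in_free_alg)

lemma filtration_mono: "N \<le> M \<Longrightarrow> filtration wt N \<subseteq> filtration wt M"
  unfolding filtration_def by (intro image_mono fa.span_mono) auto

lemma filtration_mult:
  assumes wt: "\<And>u v. wt (u @ v) = wt u + wt v"
    and a: "a \<in> filtration wt N" and b: "b \<in> filtration wt M"
  shows "a \<otimes> b \<in> filtration wt (N + M)"
proof -
  let ?W = "\<lambda>N. word ` {u. set u \<subseteq> L \<and> wt u \<le> N} :: ('i monomial \<Rightarrow>\<^sub>0 'k) set"
  have word_mult: "word u * q \<in> fa.span (?W (N + M))" if "q \<in> fa.span (?W M)" "set u \<subseteq> L" "wt u \<le> N" for q u
  proof -
    have "fa.subspace {q. word u * q \<in> fa.span (?W (N + M))}"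
      by (rule fa.subspaceI)
        (auto simp: distrib_left scl_mult_right fa.span_zero fa.span_add fa.span_scale)
    moreover have "?W M \<subseteq> {q. word u * q \<in> fa.span (?W (N + M))}"
      using that by (auto simp: wt simp flip: word_append intro!: fa.span_base imageI)
    ultimately show ?thesis
      using fa.span_minimal that(1) by blast
  qed
  obtain p q where p: "p \<in> fa.span (?W N)" "a = \<phi> p" and q: "q \<in> fa.span (?W M)" "b = \<phi> q"
    using a b by (auto simp: filtration_def)
  have "fa.subspace {p. p * q \<in> fa.span (?W (N + M))}"
    by (rule fa.subspaceI)
      (auto simp: distrib_right scl_mult_left fa.span_zero fa.span_add fa.span_scale)
  moreover have "?W N \<subseteq> {p. p * q \<in> fa.span (?W (N + M))}"
    using word_mult[OF q(1)] by auto
  ultimately have "p * q \<in> fa.span (?W (N + M))"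
    using fa.span_minimal p(1) by blast
  moreover have "a \<otimes> b = \<phi> (p * q)"
    using subsetD[OF span_subset_free_alg[OF words_in_free_alg] p(1)]
      subsetD[OF span_subset_free_alg[OF words_in_free_alg] q(1)] p(2) q(2) by (simp add: hom_mult)
  ultimately show ?thesis
    by (simp add: filtration_def)
qed

text \<open>Finitely many elements involve finitely many words, and the sum of the weights bounds
  each of them.\<close>

lemma finite_subset_filtration:
  assumes "finite G" "G \<subseteq> carrier A"
  obtains m where "G \<subseteq> filtration wt m"
proof -
  have "\<exists>m. g \<in> filtration wt m" if "g \<in> G" for g
  proof -
    have "g \<in> \<phi> ` free_alg L"
      using assms(2) that by (auto simp: image)
    then obtain p where p: "p \<in> free_alg L" "g = \<phi> p"
      by blast
    define m where "m = (\<Sum>w\<in>Poly_Mapping.keys p. wt (letters w))"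
    have "p \<in> fa.span (word ` {u. set u \<subseteq> L \<and> wt u \<le> m})"
    proof (subst sum_words, intro fa.span_sum fa.span_scale fa.span_base imageI CollectI conjI)
      fix w assume w: "w \<in> Poly_Mapping.keys p"
      show "set (letters w) \<subseteq> L"
        using w p(1) by (simp add: free_alg_def)
      show "wt (letters w) \<le> m"
        unfolding m_def using w by (intro member_le_sum) auto
    qed
    with p(2) show ?thesis
      by (auto simp: filtration_def)
  qed
  then obtain m where m: "\<And>g. g \<in> G \<Longrightarrow> g \<in> filtration wt (m g)"
    by metis
  have "G \<subseteq> filtration wt (sum m G)"
  proof
    fix g assume g: "g \<in> G"
    then have "m g \<le> sum m G"
      using assms(1) by (intro member_le_sum) auto
    then show "g \<in> filtration wt (sum m G)"
      using m[OF g] filtration_mono by blast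
  qed
  then show ?thesis
    by (rule that)
qed

lemma pow_space_subset:
  assumes wt: "\<And>u v. wt (u @ v) = wt u + wt v" and V: "V \<subseteq> filtration wt m"
  shows "pow_space A V k \<subseteq> filtration wt (m * k)"
proof (induction k)
  case 0
  have "wt [] = 0"
    using wt[of "[]" "[]"] by simp
  then have "word [] \<in> word ` {u. set u \<subseteq> L \<and> wt u \<le> 0}"
    by simp
  then have "\<one> \<in> filtration wt 0"
    unfolding filtration_def hom_one[symmetric] word_Nil[symmetric] by (rule imageI[OF fa.span_base])
  then have "lin_span A {\<one>} \<subseteq> filtration wt 0"
    by (intro V.span_is_subset[OF _ filtration_submodule]) auto
  then show ?case
    by simp
next
  case (Suc k)
  have "{v \<otimes> w |v w. v \<in> pow_space A V k \<and> w \<in> V} \<subseteq> filtration wt (m * Suc k)"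
    using filtration_mult[OF wt, of _ "m * k" _ m] Suc V by (auto simp: add.commute)
  then show ?case
    by (simp add: prod_space_def V.span_is_subset[OF _ filtration_submodule])
qed

lemma sum_pow_space_subset:
  assumes wt: "\<And>u v. wt (u @ v) = wt u + wt v" and V: "V \<subseteq> filtration wt m"
  shows "sum_pow_space A V n \<subseteq> filtration wt (m * n)"
  unfolding sum_pow_space_def
proof (rule V.span_is_subset[OF _ filtration_submodule], intro UN_least)
  fix k assume "k \<in> {..n}"
  then show "pow_space A V k \<subseteq> filtration wt (m * n)"
    using pow_space_subset[OF wt V, of k] filtration_mono[of "m * k" "m * n" wt] by auto
qed

lemma pow_space_closed: "V \<subseteq> carrier A \<Longrightarrow> pow_space A V k \<subseteq> carrier A"
proof (induction k)
  case (Suc k)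
  then have "{v \<otimes> w |v w. v \<in> pow_space A V k \<and> w \<in> V} \<subseteq> carrier A"
    by auto
  then show ?case
    by (simp add: prod_space_def V.span_is_subset2)
qed (simp add: V.span_is_subset2)

text \<open>A finite-dimensional \<open>V\<close> lies in some filtration step \<open>m\<close>. The
  sum of its powers up to \<open>n\<close> then lies in step \<open>m * n\<close>, so its dimension
  is at most \<open>(m * n + 1) ^ d\<close>.\<close>

lemma GKdim_le:
  assumes wt: "\<And>u v. wt (u @ v) = wt u + wt v"
    and red: "\<And>u N. set u \<subseteq> L \<Longrightarrow> wt u \<le> N \<Longrightarrow> word u \<in> fa.span (ker \<union> word ` B N)"
    and B: "\<And>N. finite (B N)" "\<And>N. card (B N) \<le> (N + 1) ^ d" "\<And>u N. u \<in> B N \<Longrightarrow> set u \<subseteq> L"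
  shows "GKdim A \<le> ereal (real (d + 1))"
  unfolding GKdim_def
proof (rule SUP_least, elim CollectE conjE)
  fix V assume V: "subspace (class_ring :: 'k ring) V A"
    and fin: "vectorspace.fin_dim (class_ring :: 'k ring) (A\<lparr>carrier := V\<rparr>)"
  interpret W: vectorspace "class_ring :: 'k ring" "A\<lparr>carrier := V\<rparr>"
    by (rule V.subspace_is_vs[OF V])
  have sub: "submodule (class_ring :: 'k ring) V A"
    by (rule V.is_module[OF V])
  then have VA: "V \<subseteq> carrier A"
    by (simp add: submodule_def)
  obtain G where G: "finite G" "G \<subseteq> V" "W.span G = V"
    using fin by (auto simp: W.fin_dim_def)
  then obtain m where "G \<subseteq> filtration wt m"
    using finite_subset_filtration[of G wt] VA by blast
  then have "lin_span A G \<subseteq> filtration wt m"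
    by (rule V.span_is_subset[OF _ filtration_submodule])
  then have Vm: "V \<subseteq> filtration wt m"
    using V.span_li_not_depend(1)[OF G(2) sub] G(3) by simp
  have filtration_red: "filtration wt N \<subseteq> lin_span A (\<phi> ` word ` B N)" for N
  proof -
    have BN: "word ` B N \<subseteq> free_alg L"
      using B(3) by auto
    have "fa.span (word ` {u. set u \<subseteq> L \<and> wt u \<le> N}) \<subseteq> fa.span (ker \<union> word ` B N)"
      by (rule fa.span_minimal) (auto intro: red)
    then show ?thesis
      using image_span_ker[OF BN] by (auto simp: filtration_def)
  qed
  have dim: "space_dim A (sum_pow_space A V n) \<le> (m * n + 1) ^ d" for n
  proof -
    let ?X = "\<phi> ` word ` B (m * n)"
    have "submodule (class_ring :: 'k ring) (sum_pow_space A V n) A"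
      unfolding sum_pow_space_def using pow_space_closed[OF VA] by (intro V.span_is_submodule) auto
    then have "subspace (class_ring :: 'k ring) (sum_pow_space A V n) A"
      by (intro subspace.intro V.vectorspace_axioms)
    moreover have "?X \<subseteq> carrier A"
      using B(3) by auto
    moreover have "sum_pow_space A V n \<subseteq> lin_span A ?X"
      using sum_pow_space_subset[OF wt Vm] filtration_red by blast
    ultimately have "space_dim A (sum_pow_space A V n) \<le> card ?X"
      using B(1) by (intro V.dim_subspace_le) auto
    also have "\<dots> \<le> card (B (m * n))"
      by (metis B(1) card_image_le finite_imageI le_trans)
    finally show ?thesis
      using B(2)[of "m * n"] by linarith
  qed
  \<comment> \<open>The constant \<open>(m + 1) ^ d\<close> is absorbed by one more factor
    \<open>n\<close>, whence \<open>d + 1\<close>; the added 1 ensures \<open>n \<ge> 2\<close>, so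
    that the base of the logarithm exceeds 1.\<close>
  have "log_dim n (space_dim A (sum_pow_space A V n)) \<le> ereal (real (d + 1))"
    if n: "n \<ge> (m + 1) ^ d + 1" for n
  proof (cases "space_dim A (sum_pow_space A V n) = 0")
    case False
    have n2: "n \<ge> 2"
      using n one_le_power[of "m + 1" d] by linarith
    have "space_dim A (sum_pow_space A V n) \<le> (m * n + 1) ^ d"
      by (rule dim)
    also have "\<dots> \<le> ((m + 1) * n) ^ d"
      using n2 by (intro power_mono) auto
    also have "\<dots> = (m + 1) ^ d * n ^ d"
      by (rule power_mult_distrib)
    also have "\<dots> \<le> n * n ^ d"
      using n by (intro mult_right_mono) auto
    finally have "real (space_dim A (sum_pow_space A V n)) \<le> real n ^ (d + 1)"
      by (metis of_nat_le_iff of_nat_power power_Suc Suc_eq_plus1)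
    then have "log (real n) (real (space_dim A (sum_pow_space A V n))) \<le> log (real n) (real n ^ (d + 1))"
      using n2 False by (intro log_mono) auto
    also have "\<dots> = real (d + 1)"
      using n2 by (subst log_nat_power) auto
    finally show ?thesis
      using False by (simp add: log_dim_def)
  qed (simp add: log_dim_def)
  then show "limsup (\<lambda>n. log_dim n (space_dim A (sum_pow_space A V n))) \<le> ereal (real (d + 1))"
    by (intro Limsup_bounded eventually_sequentiallyI)
qed

end

section \<open>The enveloping algebra of the positive Witt algebra\<close>

lemma tensor_incl_single [simp]: "tensor_incl (Poly_Mapping.single i c) = scl c (word [i])"
  by (cases "c = 0") (simp_all add: tensor_incl_def scl_word)

lemma tensor_incl_in_free_alg:
  assumes "x \<in> space_on S"
  shows "tensor_incl x \<in> free_alg S"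
proof -
  have "tensor_incl x = (\<Sum>i\<in>Poly_Mapping.keys x. scl (Poly_Mapping.lookup x i) (word [i]))"
    by (simp add: tensor_incl_def scl_word)
  also have "\<dots> \<in> free_alg S"
    using assms by (intro fa.subspace_sum[OF subspace_free_alg] fa.subspace_scale[OF subspace_free_alg])
      (auto simp: space_on_def)
  finally show ?thesis .
qed

lemma witt_bracket_in_space:
  assumes "x \<in> space_on {1..}" "y \<in> space_on {1..}"
  shows "witt_bracket x y \<in> space_on {1..}"
proof -
  have "Poly_Mapping.keys (witt_bracket x y) \<subseteq>
      (\<Union>i\<in>Poly_Mapping.keys x. Poly_Mapping.keys (\<Sum>j\<in>Poly_Mapping.keys y. Poly_Mapping.single (i + j)
        ((of_nat j - of_nat i) * (Poly_Mapping.lookup x i * Poly_Mapping.lookup y j))))"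
    unfolding witt_bracket_def by (rule keys_sum)
  also have "\<dots> \<subseteq> (\<Union>i\<in>Poly_Mapping.keys x. \<Union>j\<in>Poly_Mapping.keys y. {i + j})"
    by (intro UN_mono order_refl order_trans[OF keys_sum]) auto
  also have "\<dots> \<subseteq> {1..}"
    using assms by (fastforce simp: space_on_def)
  finally show ?thesis
    by (simp add: space_on_def)
qed

abbreviation witt_env_ideal :: "(nat monomial \<Rightarrow>\<^sub>0 'k::field) set" where
  "witt_env_ideal \<equiv> env_ideal {1..} witt_bracket"

text \<open>The bracket of vectors supported on \<open>{1..}\<close> is supported there, so the
  generators lie in the tensor algebra. The commutator relation is the generator for two basis
  vectors.\<close>

lemma
  shows ideal_witt_env_ideal:
    "ideal witt_env_ideal (tensor_algebra {1..} :: ('k::field, nat monomial \<Rightarrow>\<^sub>0 'k) module)"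
    and witt_env_ideal_commutator: "1 \<le> i \<Longrightarrow> 1 \<le> j \<Longrightarrow>
      word [i, j] - word [j, i] - scl (of_nat j - of_nat i) (word [i + j]) \<in> (witt_env_ideal :: (nat monomial \<Rightarrow>\<^sub>0 'k) set)"
proof -
  interpret T: presentation "tensor_algebra {1..} :: ('k, nat monomial \<Rightarrow>\<^sub>0 'k) module" "\<lambda>p. p" "{1..}"
    by (rule presentation_tensor_algebra)
  let ?G = "{tensor_incl x * tensor_incl y - tensor_incl y * tensor_incl x - tensor_incl (witt_bracket x y) | x y.
        x \<in> space_on {1..} \<and> y \<in> space_on {1..}} :: (nat monomial \<Rightarrow>\<^sub>0 'k) set"
  have G: "?G \<subseteq> carrier (tensor_algebra {1..})"
    by (auto simp: tensor_algebra_simps simp del: One_nat_def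
        intro!: T.free_alg_diff mult_in_free_alg tensor_incl_in_free_alg witt_bracket_in_space)
  show "ideal witt_env_ideal (tensor_algebra {1..} :: ('k, nat monomial \<Rightarrow>\<^sub>0 'k) module)"
    unfolding env_ideal_def by (rule T.genideal_ideal[OF G])
  assume ij: "1 \<le> i" "1 \<le> j"
  let ?x = "Poly_Mapping.single i 1 :: nat \<Rightarrow>\<^sub>0 'k" and ?y = "Poly_Mapping.single j 1 :: nat \<Rightarrow>\<^sub>0 'k"
  have "word [i, j] - word [j, i] - scl (of_nat j - of_nat i) (word [i + j]) =
      tensor_incl ?x * tensor_incl ?y - tensor_incl ?y * tensor_incl ?x - tensor_incl (witt_bracket ?x ?y)"
    by (simp add: witt_bracket_def flip: word_append)
  also have "\<dots> \<in> ?G"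
    using ij by (intro CollectI exI[of _ ?x] exI[of _ ?y]) (simp add: space_on_def)
  finally show "word [i, j] - word [j, i] - scl (of_nat j - of_nat i) (word [i + j]) \<in> (witt_env_ideal :: (nat monomial \<Rightarrow>\<^sub>0 'k) set)"
    using T.genideal_self[OF G] unfolding env_ideal_def by blast
qed

definition UW_map :: "(nat monomial \<Rightarrow>\<^sub>0 'k::field) \<Rightarrow> (nat monomial \<Rightarrow>\<^sub>0 'k) set" where
  "UW_map p = witt_env_ideal +>\<^bsub>tensor_algebra {1..} :: ('k, nat monomial \<Rightarrow>\<^sub>0 'k) module\<^esub> p"

interpretation UW: presentation
  "UW :: ('k::field, (nat monomial \<Rightarrow>\<^sub>0 'k) set) module" UW_map "{1..}"
  unfolding UW_def univ_env_def UW_map_def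
  by (rule presentation.presentation_quot[OF presentation_tensor_algebra ideal_witt_env_ideal])

lemma UW_map_env_ideal:
  fixes p :: "nat monomial \<Rightarrow>\<^sub>0 'k::field"
  assumes "p \<in> witt_env_ideal"
  shows "UW_map p = \<zero>\<^bsub>UW :: ('k, (nat monomial \<Rightarrow>\<^sub>0 'k) set) module\<^esub>"
proof -
  interpret ideal witt_env_ideal "tensor_algebra {1..} :: ('k, nat monomial \<Rightarrow>\<^sub>0 'k) module"
    by (rule ideal_witt_env_ideal)
  show ?thesis
    unfolding UW_map_def UW_def univ_env_def quot_algebra_simps by (rule a_rcos_const[OF assms])
qed

text \<open>A product of generators is the image of a word, so the order filtration comes from word
  length.\<close>

lemma UW_filtration_eq:
  "(UW_filtration m :: (nat monomial \<Rightarrow>\<^sub>0 'k::field) set set) =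
    UW_map ` fa.span (word ` {u. set u \<subseteq> {1..} \<and> length u \<le> m})"
proof -
  let ?UW = "UW :: ('k, (nat monomial \<Rightarrow>\<^sub>0 'k) set) module"
  have gen: "UW_gen i = (UW_map (word [i]) :: (nat monomial \<Rightarrow>\<^sub>0 'k) set)" for i
    by (simp add: UW_gen_def univ_env_incl_def UW_map_def)
  have "foldr (\<lambda>i u. UW_gen i \<otimes>\<^bsub>?UW\<^esub> u) is \<one>\<^bsub>?UW\<^esub> = UW_map (word is)" if "set is \<subseteq> {1..}" for "is"
    using that
  proof (induction "is")
    case Nil
    then show ?case
      by (simp add: word_Nil UW.hom_one)
  next
    case (Cons i "is")
    then have "UW_map (word [i] * word is) = UW_gen i \<otimes>\<^bsub>?UW\<^esub> UW_map (word is)"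
      unfolding gen by (intro UW.hom_mult) auto
    with Cons show ?case
      by (simp flip: word_append)
  qed
  then have *: "{foldr (\<lambda>i u. UW_gen i \<otimes>\<^bsub>?UW\<^esub> u) is \<one>\<^bsub>?UW\<^esub> | is. length is \<le> m \<and> set is \<subseteq> {1..}} =
      UW_map ` word ` {u. set u \<subseteq> {1..} \<and> length u \<le> m}"
    unfolding image_image by (auto intro!: image_eqI)
  show ?thesis
    unfolding UW_filtration_def * by (rule UW.span_image[OF UW.words_in_free_alg])
qed

text \<open>Serves both \<open>UW\<close> and its quotient by \<open>I\<close>, whose presentations
  annihilate \<open>witt_env_ideal\<close>.\<close>

lemma witt_ideal_ker:
  fixes \<psi> :: "(nat monomial \<Rightarrow>\<^sub>0 'c::field_char_0) \<Rightarrow> 'd"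
  assumes "presentation B \<psi> {1..}" "\<And>p. p \<in> witt_env_ideal \<Longrightarrow> \<psi> p = \<zero>\<^bsub>B\<^esub>"
  shows "witt_ideal (presentation.ker B \<psi> {1..})"
proof -
  interpret B: presentation B \<psi> "{1..}" by fact
  show ?thesis
  proof (rule witt_ideal.intro[OF B.subspace_ker B.ker_mult_left B.ker_mult_right])
    fix i j :: nat assume ij: "1 \<le> i" "1 \<le> j"
    then have "word [i, j] - word [j, i] - scl (of_nat j - of_nat i) (word [i + j]) \<in> free_alg {1..}"
      by (intro B.free_alg_diff B.free_alg_scale) auto
    then show "word [i, j] - word [j, i] - scl (of_nat j - of_nat i) (word [i + j]) \<in> B.ker"
      using assms(2)[OF witt_env_ideal_commutator[OF ij]] by (simp add: B.ker_def del: One_nat_def)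
  qed
qed

theorem theorem1p7:
  fixes I :: "(nat monomial \<Rightarrow>\<^sub>0 'k::field_char_0) set set"
    and f :: "(nat monomial \<Rightarrow>\<^sub>0 'k) set"
  assumes "ideal I (UW :: ('k, (nat monomial \<Rightarrow>\<^sub>0 'k) set) module)"
    and "f \<in> I"
    and "f \<noteq> \<zero>\<^bsub>UW :: ('k, (nat monomial \<Rightarrow>\<^sub>0 'k) set) module\<^esub>"
    and "UW_order f \<le> 2"
  shows "GKdim (quot_algebra (UW :: ('k, (nat monomial \<Rightarrow>\<^sub>0 'k) set) module) I) < \<infinity>"
proof -
  let ?UW = "UW :: ('k, (nat monomial \<Rightarrow>\<^sub>0 'k) set) module"
  let ?A = "quot_algebra ?UW I"
  define \<phi> where "\<phi> p = I +>\<^bsub>?UW\<^esub> UW_map p" for p :: "nat monomial \<Rightarrow>\<^sub>0 'k"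
  interpret I: ideal I ?UW by fact
  interpret A: presentation ?A \<phi> "{1..}"
    unfolding \<phi>_def by (rule UW.presentation_quot[OF assms(1)])
  have \<phi>_zero: "\<phi> p = \<zero>\<^bsub>?A\<^esub>" if "UW_map p \<in> I" for p
    unfolding \<phi>_def quot_algebra_simps by (rule I.a_rcos_const[OF that])
  interpret UWker: witt_ideal "UW.ker :: (nat monomial \<Rightarrow>\<^sub>0 'k) set"
    by (rule witt_ideal_ker[OF UW.presentation_axioms UW_map_env_ideal])
  interpret Aker: witt_ideal A.ker
    by (rule witt_ideal_ker[OF A.presentation_axioms]) (simp add: \<phi>_zero UW_map_env_ideal)

  \<comment> \<open>\<open>UW_order\<close> is defined by \<open>LEAST\<close>, so some filtration
    step containing \<open>f\<close> has to be exhibited first.\<close>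
  have "{f} \<subseteq> carrier ?UW"
    using assms(2) I.a_subset by blast
  then obtain m where "{f} \<subseteq> UW.filtration length m"
    using UW.finite_subset_filtration[of "{f}" length] by blast
  then have "f \<in> UW_filtration m"
    by (simp only: UW_filtration_eq UW.filtration_def insert_subset)
  then have "f \<in> UW_filtration (UW_order f)"
    unfolding UW_order_def by (rule LeastI)
  then obtain q where q: "q \<in> fa.span (word ` {u. set u \<subseteq> {1..} \<and> length u \<le> UW_order f})" "f = UW_map q"
    by (auto simp: UW_filtration_eq)
  \<comment> \<open>Sorting takes place modulo the kernel of the map to \<open>UW\<close>, so that
    the sorted \<open>p\<close> still represents \<open>f\<close> and is nonzero because
    \<open>f\<close> is. Only afterwards is \<open>p\<close> regarded as an element of
    \<open>A.ker\<close>.\<close>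
  have "word u \<in> UWker.red short_sorted" if "set u \<subseteq> {1..}" "length u \<le> UW_order f" for u
    by (rule UWker.sort_short_word[OF that(1) order_trans[OF that(2) assms(4)]])
  then have red: "fa.span (word ` {u. set u \<subseteq> {1..} \<and> length u \<le> UW_order f}) \<subseteq> UWker.red short_sorted"
    by (intro fa.span_minimal UWker.subspace_red image_subsetI) simp_all
  obtain p where p: "p \<in> fa.span (word ` short_sorted)" "q - p \<in> UW.ker"
    by (rule UWker.red_decompose[OF subsetD[OF red q(1)]])
  have short: "word ` short_sorted \<subseteq> (free_alg {1..} :: (nat monomial \<Rightarrow>\<^sub>0 'k) set)"
    by (auto simp: short_sorted_def)
  have free: "p \<in> free_alg {1..}" "q \<in> free_alg {1..}"
    by (rule subsetD[OF UW.span_subset_free_alg[OF short] p(1)])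
      (rule subsetD[OF UW.span_subset_free_alg[OF UW.words_in_free_alg] q(1)])
  have fp: "f = UW_map p"
    using UW.hom_eq_of_ker[OF free(2,1) p(2)] q(2) by simp
  have p0: "p \<noteq> 0"
    using assms(3) fp UW.hom_zero by auto
  have p_ker: "p \<in> A.ker"
    using free assms(2) fp by (simp add: A.ker_def \<phi>_zero del: One_nat_def)
  obtain K C where KC: "\<And>u N. set u \<subseteq> {1..} \<Longrightarrow> weight C u \<le> N \<Longrightarrow> word u \<in> Aker.red (nf K N)"
    by (rule Aker.normal_forms[OF p_ker p0 keys_span_words[OF p(1)]]) (assumption | erule that)+
  \<comment> \<open>\<open>card_nf\<close> gives the exponent \<open>K + 1\<close>, and
    \<open>GKdim_le\<close> adds 1.\<close>
  have "GKdim ?A \<le> ereal (real (K + 1 + 1))"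
  proof (rule A.GKdim_le)
    show "word u \<in> fa.span (A.ker \<union> word ` nf K N)" if "set u \<subseteq> {1..}" "weight C u \<le> N" for u N
      using KC[OF that] unfolding Aker.red_def .
    show "finite (nf K N)" "card (nf K N) \<le> (N + 1) ^ (K + 1)" for N
      by (fact card_nf)+
    show "set u \<subseteq> {1..}" if "u \<in> nf K N" for u N
      using that by (rule nf_letters)
  qed (rule weight_simps)
  also have "\<dots> < \<infinity>"
    by simp
  finally show ?thesis .
qed

end
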